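(* Let $(\Omega,\mathcal F,\mathbb P)$ be nonatomic, $X$ a bounded random vector in $\mathbb R^N$ with $\mathbb E(X)=0$, and $Y$ a bounded real random variable. Then $$\sup\{\mathbb E(VY):\ \mathrm{Law}(V)=\mathrm{uniform}([0,1]),\ \mathbb E(X\mid V)=0\}$$ equals $$\sup\Big\{\mathbb E\Big(\int_0^1U_tY\,dt\Big):\ t\mapsto U_t\text{ nonincreasing},\ U_t\in[0,1],\ \mathbb E(U_t)=1-t,\ \mathbb E(U_tX)=0\ \text{for all }t\in[0,1]\Big\},$$ the latter supremum being over jointly measurable families $(U_t)_{t\in[0,1]}$ of random variables.
   Context: The second problem is the Koenker–Bassett dual problem $\sup\{\mathbb E(U_tY):U_t\in[0,1],\ \mathbb E(U_t)=1-t,\ \mathbb E(U_tX)=0\}$, integrated over $t$, with the additional constraint that $U_t$ is nonincreasing in $t$. *)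

theory Defs
  imports "HOL-Probability.Probability"
begin

definition nonatomic :: "'a measure \<Rightarrow> bool" where
  "nonatomic M \<longleftrightarrow> (\<forall>A\<in>sets M. 0 < measure M A \<longrightarrow>
      (\<exists>B\<in>sets M. B \<subseteq> A \<and> 0 < measure M B \<and> measure M B < measure M A))"

definition adm_V :: "'a measure \<Rightarrow> ('a \<Rightarrow> real^'n) \<Rightarrow> ('a \<Rightarrow> real) \<Rightarrow> bool" where
  "adm_V M X V \<longleftrightarrow> V \<in> borel_measurable M \<and>
     distr M lborel V = uniform_measure lborel {0..1} \<and>
     (\<forall>i. AE \<omega> in M. real_cond_exp M (vimage_algebra (space M) V borel) (\<lambda>\<omega>. X \<omega> $ i) \<omega> = 0)"

definition adm_U :: "'a measure \<Rightarrow> ('a \<Rightarrow> real^'n) \<Rightarrow> (real \<Rightarrow> 'a \<Rightarrow> real) \<Rightarrow> bool" where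
  "adm_U M X U \<longleftrightarrow>
     (\<lambda>(t, \<omega>). U t \<omega>) \<in> borel_measurable (restrict_space lborel {0..1} \<Otimes>\<^sub>M M) \<and>
     (\<forall>\<omega>\<in>space M. \<forall>s\<in>{0..1}. \<forall>t\<in>{0..1}. s \<le> t \<longrightarrow> U t \<omega> \<le> U s \<omega>) \<and>
     (\<forall>t\<in>{0..1}. \<forall>\<omega>\<in>space M. 0 \<le> U t \<omega> \<and> U t \<omega> \<le> 1) \<and>
     (\<forall>t\<in>{0..1}. (\<integral>\<omega>. U t \<omega> \<partial>M) = 1 - t) \<and>
     (\<forall>t\<in>{0..1}. (\<integral>\<omega>. U t \<omega> *\<^sub>R X \<omega> \<partial>M) = 0)"

end

theory Submission
  imports Defs
begin

text \<open>A uniform \<open>V\<close> with \<open>E (X | V) = 0\<close> yields the family \<open>1 {V > t}\<close> with the same value. Conversely, the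
  levels \<open>U (k / n)\<close> of an admissible family are purified to a decreasing chain of sets with the same
  moments against \<open>1\<close>, \<open>X\<close> and \<open>Y\<close>, and the layers between them are split uniformly and orthogonally
  to \<open>X\<close>; this changes the value by \<open>O (1 / n)\<close>.

  Both constructions need Lyapunov's convexity theorem, obtained by induction on the number of
  moments: a set that halves the moments in \<open>F\<close> inside every set gives a splitting \<open>E t\<close>, increasing
  in \<open>t\<close>, with all moments in \<open>F\<close> proportional to \<open>t\<close>; then \<open>E (t + 1 / 2) - E t\<close> halves all of \<open>F\<close>, and
  the intermediate value theorem selects a \<open>t\<close> for which it halves one more moment.\<close>

subsection \<open>Uniform splittings\<close>

text \<open>The pairs to be matched are \<open>V\<close> and the indicators of
  \<open>{V > t}\<close>: \<open>E (X | V) = 0\<close> says exactly that \<open>X\<close> integrates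
  to 0 over all these sets. The obstacle is that this is a continuum of exact constraints, while
  Lyapunov's theorem handles finitely many moments at a time. The constraints between the chosen
  levels are therefore met exactly, by a fresh splitting inside each layer, and only the value is
  allowed to drift; for an equality of suprema that is enough. \<open>Y\<close> is among the
  purified moments, so the chosen levels themselves lose nothing.

  The second obstacle is monotonicity: levels purified one by one would give unrelated sets, which
  are not the superlevel sets of any \<open>V\<close>. Hence the chain.

  Halving alone would not survive the induction on moments. A single halving set leaves no freedom
  for one more moment, whereas a splitting supplies a one-parameter family of sets that all halve
  the old ones.\<close>

definition ess_bounded :: "'a measure \<Rightarrow> ('a \<Rightarrow> real) set" where
  "ess_bounded M = {f \<in> borel_measurable M. \<exists>C. AE x in M. \<bar>f x\<bar> \<le> C}"

lemma ess_boundedI: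
  "f \<in> borel_measurable M \<Longrightarrow> (\<And>x. x \<in> space M \<Longrightarrow> \<bar>f x\<bar> \<le> C) \<Longrightarrow> f \<in> ess_bounded M"
  unfolding ess_bounded_def by (auto intro!: exI[of _ C])

text \<open>Moments are repeatedly multiplied by weights and indicators, and the results must again
  be admissible moments.\<close>

lemma ess_bounded_mult:
  assumes "f \<in> ess_bounded M" "g \<in> ess_bounded M"
  shows "(\<lambda>x. f x * g x) \<in> ess_bounded M"
proof -
  obtain C D where C: "AE x in M. \<bar>f x\<bar> \<le> C" and D: "AE x in M. \<bar>g x\<bar> \<le> D"
    using assms unfolding ess_bounded_def by auto
  have "AE x in M. \<bar>f x * g x\<bar> \<le> C * D"
    using C D by eventually_elim (auto simp: abs_mult intro!: mult_mono)
  then show ?thesis using assms unfolding ess_bounded_def by auto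
qed

lemma ess_bounded_indicator: "A \<in> sets M \<Longrightarrow> indicator A \<in> ess_bounded M"
  by (rule ess_boundedI[where C=1]) (auto simp: indicator_def)

context finite_measure
begin

lemma ess_bounded_integrable: "f \<in> ess_bounded M \<Longrightarrow> integrable M f"
  unfolding ess_bounded_def using integrable_const_bound[of f] by auto

lemma ess_bounded_set_integrable:
  "f \<in> ess_bounded M \<Longrightarrow> A \<in> sets M \<Longrightarrow> set_integrable M A f"
  unfolding set_integrable_def
  by (intro integrable_mult_indicator ess_bounded_integrable)

lemma set_integral_bound:
  fixes f :: "'a \<Rightarrow> real"
  assumes f: "f \<in> borel_measurable M" "AE x in M. \<bar>f x\<bar> \<le> C" and A: "A \<in> sets M"
  shows "\<bar>LINT x:A|M. f x\<bar> \<le> C * measure M A"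
proof -
  have fb: "f \<in> ess_bounded M" using f unfolding ess_bounded_def by auto
  have "\<bar>LINT x:A|M. f x\<bar> \<le> (LINT x|M. \<bar>indicator A x *\<^sub>R f x\<bar>)"
    unfolding set_lebesgue_integral_def by (rule integral_abs_bound)
  also have "\<dots> \<le> (LINT x|M. C * indicator A x)"
  proof (rule integral_mono_AE)
    show "integrable M (\<lambda>x. \<bar>indicator A x *\<^sub>R f x\<bar>)"
      using ess_bounded_set_integrable[OF fb A] unfolding set_integrable_def by auto
    show "AE x in M. \<bar>indicator A x *\<^sub>R f x\<bar> \<le> C * indicator A x"
      using f(2) by eventually_elim (auto simp: indicator_def)
  qed (use A in \<open>auto simp: less_top[symmetric]\<close>)
  finally show ?thesis using A by auto
qed

lemma set_integral_Diff_subset: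
  fixes f :: "'a \<Rightarrow> real"
  assumes "f \<in> ess_bounded M" "A \<in> sets M" "B \<in> sets M" "B \<subseteq> A"
  shows "(LINT x:A - B|M. f x) = (LINT x:A|M. f x) - (LINT x:B|M. f x)"
proof -
  have "(LINT x:(A - B) \<union> B|M. f x) = (LINT x:A - B|M. f x) + (LINT x:B|M. f x)"
    by (rule set_integral_Un) (use assms in \<open>auto intro!: ess_bounded_set_integrable\<close>)
  moreover have "(A - B) \<union> B = A" using assms by auto
  ultimately show ?thesis by simp
qed

lemma set_integral_one: "A \<in> sets M \<Longrightarrow> (LINT x:A|M. (1::real)) = measure M A"
  by (simp add: set_lebesgue_integral_def)

text \<open>Iterated halving makes the binary digits of \<open>V\<close>: the level sets of \<open>K n\<close> are the \<open>2 ^ n\<close> cells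
  of the \<open>n\<close>-th generation.\<close>

lemma halving_imp_uniform_splitting:
  fixes F :: "('a \<Rightarrow> real) set"
  assumes F: "F \<subseteq> ess_bounded M" and one: "(\<lambda>_. 1) \<in> F"
    and half: "\<And>A. A \<in> sets M \<Longrightarrow>
      \<exists>B\<in>sets M. B \<subseteq> A \<and> (\<forall>f\<in>F. (LINT x:B|M. f x) = (LINT x:A|M. f x) / 2)"
    and A: "A \<in> sets M"
  shows "\<exists>V\<in>borel_measurable M. (\<forall>x. V x \<in> {0..1}) \<and>
    (\<forall>f\<in>F. \<forall>t\<in>{0..1}. (LINT x:{x\<in>A. V x \<le> t}|M. f x) = t * (LINT x:A|M. f x))"
proof -
  obtain h where h: "\<And>A. A \<in> sets M \<Longrightarrow> h A \<in> sets M"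
      "\<And>A. A \<in> sets M \<Longrightarrow> h A \<subseteq> A"
      "\<And>A f. A \<in> sets M \<Longrightarrow> f \<in> F \<Longrightarrow> (LINT x:h A|M. f x) = (LINT x:A|M. f x) / 2"
    using half by metis
  \<comment> \<open>The digit 0 marks membership in the chosen half of the current cell, so
    \<open>K n x\<close> is the integer written with the first \<open>n\<close> binary
    digits.\<close>
  define K :: "nat \<Rightarrow> 'a \<Rightarrow> nat" where
    "K = rec_nat (\<lambda>_. 0) (\<lambda>n k x. 2 * k x + of_bool (x \<notin> h {y\<in>A. k y = k x}))"
  define cell where "cell n k = {x\<in>A. K n x = k}" for n k
  have K0: "K 0 x = 0" for x by (simp add: K_def)
  have KS: "K (Suc n) x = 2 * K n x + of_bool (x \<notin> h (cell n (K n x)))" for n x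
    by (simp add: K_def cell_def)
  have As: "A \<subseteq> space M" using A sets.sets_into_space by auto
  have cellI: "cell n k \<in> sets M" if "K n \<in> measurable M (count_space UNIV)" for n k
  proof -
    have "cell n k = A \<inter> (K n -` {k} \<inter> space M)" using As by (auto simp: cell_def)
    then show ?thesis using A measurable_sets[OF that, of "{k}"] by auto
  qed
  have Km: "K n \<in> measurable M (count_space UNIV)" for n
  proof (induction n)
    case 0 then show ?case using K0 by (simp add: fun_eq_iff[of "K 0" "\<lambda>_. 0", symmetric])
  next
    case (Suc n)
    have hm: "h (cell n k) \<in> sets M" for k using cellI[OF Suc] h(1) by auto
    \<comment> \<open>The next digit tests a set that itself varies with \<open>K n x\<close>. As
      \<open>K n\<close> takes countably many values, measurability for each fixed \<open>k\<close>
      suffices.\<close>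
    have "(\<lambda>x. 2 * K n x + of_bool (x \<notin> h (cell n (K n x)))) \<in> measurable M (count_space UNIV)"
    proof (rule measurable_compose_countable[where g="K n" and f="\<lambda>k x. 2 * k + of_bool (x \<notin> h (cell n k))"])
      fix k
      have [measurable]: "h (cell n k) \<in> sets M" by (rule hm)
      show "(\<lambda>x. 2 * k + of_bool (x \<notin> h (cell n k))) \<in> measurable M (count_space UNIV)"
        by measurable
    qed (rule Suc)
    then show ?case by (simp add: KS[abs_def])
  qed
  have cellm: "cell n k \<in> sets M" for n k by (rule cellI[OF Km])
  have cell_even: "cell (Suc n) (2 * k) = h (cell n k)" for n k
  proof -
    have "K n x = k" if "x \<in> h (cell n k)" for x
      using that h(2)[OF cellm, of n k] by (auto simp: cell_def)
    moreover have "x \<in> A" if "x \<in> h (cell n k)" for x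
      using that h(2)[OF cellm, of n k] by (auto simp: cell_def)
    ultimately show ?thesis by (auto simp: cell_def[of "Suc n"] KS of_bool_def split: if_splits) presburger+
  qed
  have cell_odd: "cell (Suc n) (2 * k + 1) = cell n k - h (cell n k)" for n k
    by (auto simp: cell_def[of "Suc n"] KS of_bool_def split: if_splits)
       (auto simp: cell_def, presburger+)
  have cell_int: "k < 2 ^ n \<Longrightarrow> (LINT x:cell n k|M. f x) = (LINT x:A|M. f x) / 2 ^ n"
    if f: "f \<in> F" for f n k
  proof (induction n arbitrary: k)
    case 0 then show ?case by (simp add: cell_def K0)
  next
    case (Suc n)
    define j where "j = k div 2"
    have j: "j < 2 ^ n" using Suc.prems by (auto simp: j_def)
    have e: "(LINT x:h (cell n j)|M. f x) = (LINT x:A|M. f x) / 2 ^ Suc n"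
      using h(3)[OF cellm f, of n j] Suc.IH[OF j] by simp
    show ?case
    proof (cases "even k")
      case True
      then have "k = 2 * j" by (simp add: j_def)
      then show ?thesis using e by (simp add: cell_even)
    next
      case False
      then have k: "k = 2 * j + 1" by (simp add: j_def)
      show ?thesis unfolding k cell_odd
        using set_integral_Diff_subset[of f "cell n j" "h (cell n j)"] e Suc.IH[OF j] f F h(1,2) cellm
        by (auto simp: field_simps)
    qed
  qed
  have K_less: "K n x < 2 ^ n" for n x
    by (induction n) (auto simp: K0 KS of_bool_def)
  define V where "V x = (SUP n. real (K n x) / 2 ^ n)" for x
  \<comment> \<open>The dyadic intervals from \<open>K n x / 2 ^ n\<close> to
    \<open>(K n x + 1) / 2 ^ n\<close> are nested, so every left end lies below every right end and
    \<open>V x\<close> belongs to all of them.\<close>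
  have mono1: "real (K m x) / 2 ^ m \<le> real (K n x) / 2 ^ n" if "m \<le> n" for m n x
    using that by (rule lift_Suc_mono_le[where f="\<lambda>n. real (K n x) / 2 ^ n", rotated])
      (auto simp: KS field_simps)
  have mono2: "real (K n x + 1) / 2 ^ n \<le> real (K m x + 1) / 2 ^ m" if "m \<le> n" for m n x
    using that by (rule lift_Suc_antimono_le[where f="\<lambda>n. real (K n x + 1) / 2 ^ n", rotated])
      (auto simp: KS of_bool_def field_simps)
  have K_cross: "real (K m x) / 2 ^ m \<le> real (K n x + 1) / 2 ^ n" for m n x
  proof (cases "m \<le> n")
    case True
    have "real (K n x) / 2 ^ n \<le> real (K n x + 1) / 2 ^ n" by (intro divide_right_mono) auto
    then show ?thesis using mono1[OF True, of x] by linarith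
  next
    case False
    then have "n \<le> m" by simp
    have "real (K m x) / 2 ^ m \<le> real (K m x + 1) / 2 ^ m" by (intro divide_right_mono) auto
    then show ?thesis using mono2[OF \<open>n \<le> m\<close>, of x] by linarith
  qed
  have bdd: "bdd_above (range (\<lambda>n. real (K n x) / 2 ^ n))" for x
    by (rule bdd_aboveI[where M="real (K 0 x + 1) / 2 ^ 0"]) (use K_cross[of _ x 0] in auto)
  have V_ge: "real (K n x) / 2 ^ n \<le> V x" for n x
    unfolding V_def by (rule cSUP_upper[OF _ bdd]) auto
  have V_le: "V x \<le> real (K n x + 1) / 2 ^ n" for n x
    unfolding V_def by (rule cSUP_least) (use K_cross in auto)
  have Vm: "V \<in> borel_measurable M"
    unfolding V_def[abs_def]
  proof (rule borel_measurable_cSUP)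
    fix n
    have [measurable]: "K n \<in> measurable M (count_space UNIV)" by (rule Km)
    show "(\<lambda>x. real (K n x) / 2 ^ n) \<in> borel_measurable M" by measurable
  qed (use bdd in auto)
  have V01: "V x \<in> {0..1}" for x using V_ge[of 0 x] V_le[of x 0] K0[of x] by auto
  have "(LINT x:{x\<in>A. V x \<le> t}|M. f x) = t * (LINT x:A|M. f x)"
    if f: "f \<in> F" and t: "t \<in> {0..1}" for f t
  proof -
    have fb: "f \<in> ess_bounded M" using f F by auto
    then obtain C where C: "f \<in> borel_measurable M" "AE x in M. \<bar>f x\<bar> \<le> C"
      unfolding ess_bounded_def by auto
    define I where "I = (LINT x:A|M. f x)"
    define E where "E = {x\<in>A. V x \<le> t}"
    have "E = A \<inter> (V -` {..t} \<inter> space M)" using As by (auto simp: E_def)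
    then have Em: "E \<in> sets M" using A measurable_sets[OF Vm, of "{..t}"] by auto
    define P where "P n m = {x\<in>A. K n x < m}" for n m
    have P_Suc: "P n (Suc m) = P n m \<union> cell n m" for n m
      by (auto simp: P_def cell_def)
    have Pm: "P n m \<in> sets M" for n m
      by (induction m) (auto simp: P_Suc cellm, simp add: P_def)
    have P_int: "m \<le> 2 ^ n \<Longrightarrow> (LINT x:P n m|M. f x) = real m / 2 ^ n * I" for n m
    proof (induction m)
      case 0 then show ?case by (simp add: P_def set_lebesgue_integral_def)
    next
      case (Suc m)
      have "(LINT x:P n (Suc m)|M. f x) = (LINT x:P n m|M. f x) + (LINT x:cell n m|M. f x)"
        unfolding P_Suc by (rule set_integral_Un)
          (auto simp: P_def[of n m] cell_def[of n m] intro!: ess_bounded_set_integrable fb cellm Pm[unfolded P_def] cellm[unfolded cell_def])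
      then show ?case using Suc cell_int[OF f, of m n] by (auto simp: I_def field_simps)
    qed
    \<comment> \<open>With \<open>m\<close> the integer part of \<open>t * 2 ^ n\<close>, the set
      \<open>E\<close> contains the first \<open>m\<close> cells and exceeds them by part of one
      cell. The first error term pays for that cell, the second for rounding \<open>t\<close>. The
      absolute value of \<open>C\<close> covers a null space, where an almost everywhere bound may
      be negative.\<close>
    have bound: "\<bar>(LINT x:E|M. f x) - t * I\<bar> \<le> (\<bar>C\<bar> * measure M A + \<bar>I\<bar>) / 2 ^ n" for n
    proof -
      define m where "m = nat \<lfloor>t * 2 ^ n\<rfloor>"
      have m1: "real m \<le> t * 2 ^ n" "t * 2 ^ n < real m + 1"
        using t by (auto simp: m_def)
      then have m2: "m \<le> 2 ^ n"
      proof -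
        have "t * 2 ^ n \<le> 1 * 2 ^ n" using t by (intro mult_right_mono) auto
        then have "real m \<le> 2 ^ n" using m1(1) by linarith
        then have "real m \<le> real (2 ^ n)" by simp
        then show ?thesis by (simp only: of_nat_le_iff)
      qed
      have sub1: "P n m \<subseteq> E"
      proof
        fix x assume x: "x \<in> P n m"
        have "V x \<le> real (K n x + 1) / 2 ^ n" by (rule V_le)
        also have "\<dots> \<le> real m / 2 ^ n" using x by (intro divide_right_mono) (auto simp: P_def)
        also have "\<dots> \<le> t" using m1 by (simp add: field_simps)
        finally show "x \<in> E" using x by (auto simp: E_def P_def)
      qed
      have sub2: "E - P n m \<subseteq> cell n m"
      proof
        fix x assume x: "x \<in> E - P n m"
        have "real (K n x) / 2 ^ n \<le> t" using V_ge[of n x] x by (auto simp: E_def)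
        then have "real (K n x) < real m + 1" using m1 by (simp add: field_simps)
        then show "x \<in> cell n m" using x by (auto simp: E_def P_def cell_def)
      qed
      have cm: "measure M (cell n m) \<le> measure M A / 2 ^ n"
      proof (cases "m < 2 ^ n")
        case True
        then show ?thesis using cell_int[OF one True] A cellm by (simp add: set_integral_one)
      next
        \<comment> \<open>Here \<open>t = 1\<close> and \<open>m = 2 ^ n\<close>, one past the last
          cell index.\<close>
        case False
        then have "cell n m = {}" using K_less[of n] by (auto simp: cell_def)
        then show ?thesis by simp
      qed
      have "\<bar>LINT x:E - P n m|M. f x\<bar> \<le> C * measure M (E - P n m)"
        by (rule set_integral_bound[OF C]) (use Em Pm in auto)
      also have "\<dots> \<le> \<bar>C\<bar> * (measure M A / 2 ^ n)"
        using finite_measure_mono[OF sub2 cellm] cm by (intro mult_mono) auto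
      finally have b1: "\<bar>LINT x:E - P n m|M. f x\<bar> \<le> \<bar>C\<bar> * (measure M A / 2 ^ n)" .
      have eq: "(LINT x:E|M. f x) = (LINT x:E - P n m|M. f x) + real m / 2 ^ n * I"
        using set_integral_Diff_subset[OF fb Em Pm sub1] P_int[OF m2] by simp
      have "real m / 2 ^ n \<le> t" "t \<le> (real m + 1) / 2 ^ n"
        using m1 by (auto simp: pos_divide_le_eq pos_le_divide_eq)
      then have "\<bar>real m / 2 ^ n - t\<bar> \<le> 1 / 2 ^ n" by (simp add: add_divide_distrib)
      then have "\<bar>(real m / 2 ^ n - t) * I\<bar> \<le> 1 / 2 ^ n * \<bar>I\<bar>"
        unfolding abs_mult by (intro mult_right_mono) auto
      then have b2: "\<bar>real m / 2 ^ n * I - t * I\<bar> \<le> \<bar>I\<bar> / 2 ^ n"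
        by (simp add: left_diff_distrib)
      show ?thesis using b1 b2 unfolding eq add_divide_distrib by (auto simp: abs_le_iff)
    qed
    have "(\<lambda>n. (\<bar>C\<bar> * measure M A + \<bar>I\<bar>) / 2 ^ n) \<longlonglongrightarrow> 0"
      by (rule LIMSEQ_divide_realpow_zero) simp
    then have "\<bar>(LINT x:E|M. f x) - t * I\<bar> \<le> 0"
      by (rule LIMSEQ_le_const) (use bound in auto)
    then show ?thesis by (simp add: E_def I_def)
  qed
  then show ?thesis using Vm V01 by blast
qed

text \<open>The constant 1 in \<open>F\<close> gives \<open>E t - E s\<close> a measure proportional
  to \<open>t - s\<close>. An essentially bounded \<open>g\<close> thus has a Lipschitz integral
  over \<open>E t\<close>, which is the continuity that the intermediate value theorem
  requires.\<close>

lemma uniform_splitting_imp_halving: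
  fixes F :: "('a \<Rightarrow> real) set"
  assumes F: "F \<subseteq> ess_bounded M" and one: "(\<lambda>_. 1) \<in> F" and g: "g \<in> ess_bounded M"
    and A: "A \<in> sets M" and V: "V \<in> borel_measurable M" "\<And>x. V x \<in> {0..1}"
    and split: "\<And>f t. f \<in> F \<Longrightarrow> t \<in> {0..1} \<Longrightarrow>
      (LINT x:{x\<in>A. V x \<le> t}|M. f x) = t * (LINT x:A|M. f x)"
  shows "\<exists>B\<in>sets M. B \<subseteq> A \<and> (\<forall>f\<in>insert g F. (LINT x:B|M. f x) = (LINT x:A|M. f x) / 2)"
proof -
  obtain C where C: "g \<in> borel_measurable M" "AE x in M. \<bar>g x\<bar> \<le> C"
    using g unfolding ess_bounded_def by auto
  define E where "E t = {x\<in>A. V x \<le> t}" for t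
  have As: "A \<subseteq> space M" using A sets.sets_into_space by auto
  have Em: "E t \<in> sets M" for t
  proof -
    have "E t = A \<inter> (V -` {..t} \<inter> space M)" using As by (auto simp: E_def)
    then show ?thesis using A measurable_sets[OF V(1), of "{..t}"] by auto
  qed
  have E_mono: "s \<le> t \<Longrightarrow> E s \<subseteq> E t" for s t by (auto simp: E_def)
  define G where "G t = (LINT x:E t|M. g x)" for t
  have E1: "E 1 = A" using V(2) by (auto simp: E_def)
  have mE: "measure M (E t) = t * measure M A" if "t \<in> {0..1}" for t
    using split[OF one that] A Em[of t] by (simp add: set_integral_one E_def)
  have lip: "\<bar>G t - G s\<bar> \<le> \<bar>C\<bar> * measure M A * (t - s)" if "0 \<le> s" "s \<le> t" "t \<le> 1" for s t
  proof -
    have "G t - G s = (LINT x:E t - E s|M. g x)"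
      unfolding G_def by (rule set_integral_Diff_subset[symmetric]) (use g Em E_mono that in auto)
    also have "\<bar>\<dots>\<bar> \<le> C * measure M (E t - E s)"
      by (rule set_integral_bound[OF C]) (use Em in auto)
    also have "\<dots> \<le> \<bar>C\<bar> * measure M (E t - E s)" by (intro mult_right_mono) auto
    also have "measure M (E t - E s) = t * measure M A - s * measure M A"
      using finite_measure_Diff[OF Em Em E_mono[OF that(2)]] mE that by auto
    finally show ?thesis by (simp add: algebra_simps)
  qed
  have G0: "G 0 = 0"
  proof -
    have "\<bar>G 0\<bar> \<le> C * measure M (E 0)"
      unfolding G_def by (rule set_integral_bound[OF C Em])
    then show ?thesis using mE[of 0] by simp
  qed
  have "(\<bar>C\<bar> * measure M A)-lipschitz_on {0..1} G"
  proof (rule lipschitz_on_leI)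
    fix s t :: real assume "s \<in> {0..1}" "t \<in> {0..1}" "s \<le> t"
    then show "dist (G s) (G t) \<le> \<bar>C\<bar> * measure M A * dist s t"
      using lip[of s t] by (auto simp: dist_real_def)
  qed auto
  then have cont: "continuous_on {0..1} G" by (rule lipschitz_on_continuous_on)
  define D where "D t = G (t + 1/2) - G t" for t
  have contD: "continuous_on {0..1/2} D" unfolding D_def
    by (intro continuous_intros continuous_on_compose2[OF cont]) auto
  \<comment> \<open>The sets for \<open>t = 0\<close> and \<open>t = 1/2\<close> partition
    \<open>A\<close> up to the null set \<open>E 0\<close>. Their \<open>g\<close>-integrals add up
    to the whole, so they lie on opposite sides of one half of it.\<close>
  have sumD: "D 0 + D (1/2) = G 1" using G0 by (simp add: D_def)
  have "\<exists>t\<in>{0..1/2}. D t = G 1 / 2"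
  proof (cases "D 0 \<le> G 1 / 2")
    case True
    then show ?thesis using IVT'[of D 0 "G 1 / 2" "1/2"] contD sumD by auto
  next
    case False
    then show ?thesis using IVT2'[of D "1/2" "G 1 / 2" 0] contD sumD by auto
  qed
  then obtain t where t: "t \<in> {0..1/2}" "D t = G 1 / 2" by auto
  define B where "B = E (t + 1/2) - E t"
  have sub: "E t \<subseteq> E (t + 1/2)" by (rule E_mono) auto
  have "(LINT x:B|M. f x) = (LINT x:A|M. f x) / 2" if "f \<in> insert g F" for f
  proof (cases "f \<in> F")
    case True
    have "(LINT x:B|M. f x) = (LINT x:E (t + 1/2)|M. f x) - (LINT x:E t|M. f x)"
      unfolding B_def using True F by (intro set_integral_Diff_subset Em sub) auto
    also have "\<dots> = (t + 1/2) * (LINT x:A|M. f x) - t * (LINT x:A|M. f x)"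
      unfolding E_def using split[OF True, of t] split[OF True, of "t + 1/2"] t by auto
    finally show ?thesis by (simp add: algebra_simps)
  next
    case False
    then have [simp]: "f = g" using that by auto
    have "(LINT x:B|M. f x) = D t"
      unfolding B_def D_def G_def using g by (simp add: set_integral_Diff_subset Em sub)
    then show ?thesis using t by (simp add: G_def E1)
  qed
  moreover have "B \<in> sets M" "B \<subseteq> A" using Em by (auto simp: B_def E_def)
  ultimately show ?thesis by blast
qed

section \<open>Halving sets in a nonatomic measure\<close>

text \<open>Nonatomicity gives a proper part with no control on its size, but either that part or
  its remainder has at most half the measure, and this can be iterated.\<close>

lemma nonatomic_small_subset:
  assumes na: "nonatomic M" and A: "A \<in> sets M" "0 < measure M A" and e: "0 < (e::real)"
  shows "\<exists>B\<in>sets M. B \<subseteq> A \<and> 0 < measure M B \<and> measure M B \<le> e"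
proof -
  have small: "\<exists>B\<in>sets M. B \<subseteq> A \<and> 0 < measure M B \<and> measure M B \<le> measure M A / 2 ^ n" for n
  proof (induction n)
    case 0 then show ?case using A by auto
  next
    case (Suc n)
    then obtain B where B: "B \<in> sets M" "B \<subseteq> A" "0 < measure M B" "measure M B \<le> measure M A / 2 ^ n"
      by auto
    then obtain C where C: "C \<in> sets M" "C \<subseteq> B" "0 < measure M C" "measure M C < measure M B"
      using na unfolding nonatomic_def by blast
    have d: "measure M (B - C) = measure M B - measure M C"
      using finite_measure_Diff[OF B(1) C(1,2)] .
    show ?case
    proof (cases "measure M C \<le> measure M B / 2")
      case True
      then show ?thesis using C B by (intro bexI[of _ C]) auto
    next
      case False
      then show ?thesis using C B d by (intro bexI[of _ "B - C"]) auto
    qed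
  qed
  obtain n where "measure M A / e < 2 ^ n" using real_arch_pow[of 2 "measure M A / e"] by auto
  then have "measure M A / 2 ^ n \<le> e" using e by (simp add: field_simps)
  moreover obtain B where "B \<in> sets M" "B \<subseteq> A" "0 < measure M B" "measure M B \<le> measure M A / 2 ^ n"
    using small[of n] by auto
  ultimately show ?thesis by (intro bexI[of _ B]) auto
qed

text \<open>Exhaust greedily: each step adds an admissible set of at least half the largest available
  measure, so any leftover deficit could be filled by a small set and contradict summability.\<close>

lemma nonatomic_halving:
  assumes na: "nonatomic M" and A: "A \<in> sets M"
  shows "\<exists>B\<in>sets M. B \<subseteq> A \<and> measure M B = measure M A / 2"
proof -
  define c where "c = measure M A / 2"
  define adm where "adm C = {E\<in>sets M. E \<subseteq> A - C \<and> measure M C + measure M E \<le> c}" for C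
  define s where "s C = Sup (measure M ` adm C)" for C
  have c0: "0 \<le> c" by (simp add: c_def)
  have bdd: "bdd_above (measure M ` adm C)" for C
    by (rule bdd_aboveI[where M="measure M (space M)"]) (auto simp: bounded_measure)
  have step: "\<exists>D\<in>sets M. C \<subseteq> D \<and> D \<subseteq> A \<and> measure M D \<le> c \<and> measure M D - measure M C \<ge> s C / 2"
    if C: "C \<in> sets M" "C \<subseteq> A" "measure M C \<le> c" for C
  proof -
    have ne: "{} \<in> adm C" using C by (auto simp: adm_def)
    then have s0: "s C \<ge> 0" unfolding s_def using cSup_upper[OF imageI[OF ne] bdd] by auto
    \<comment> \<open>The supremum need not be attained, so only half of it is asked for; if it is
      0, the empty set will do.\<close>
    have "\<exists>E\<in>adm C. measure M E \<ge> s C / 2"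
    proof (cases "s C = 0")
      case True then show ?thesis using ne by auto
    next
      case False
      then have "s C / 2 < Sup (measure M ` adm C)" using s0 by (simp add: s_def[symmetric])
      moreover have "measure M ` adm C \<noteq> {}" using ne by auto
      ultimately obtain E where "E \<in> adm C" "s C / 2 < measure M E"
        using less_cSup_iff[OF _ bdd] by blast
      then show ?thesis by (intro bexI[of _ E]) auto
    qed
    then obtain E where E: "E \<in> adm C" "measure M E \<ge> s C / 2" by auto
    have "measure M (C \<union> E) = measure M C + measure M E"
      using E C by (intro finite_measure_Union) (auto simp: adm_def)
    then show ?thesis using E C by (intro bexI[of _ "C \<union> E"]) (auto simp: adm_def)
  qed
  have "\<exists>C. \<forall>n. (C n \<in> sets M \<and> C n \<subseteq> A \<and> measure M (C n) \<le> c) \<and>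
      (C n \<subseteq> C (Suc n) \<and> measure M (C (Suc n)) - measure M (C n) \<ge> s (C n) / 2)"
  proof (rule dependent_nat_choice)
    show "\<exists>C. C \<in> sets M \<and> C \<subseteq> A \<and> measure M C \<le> c" using c0 by (intro exI[of _ "{}"]) auto
    show "\<exists>D. (D \<in> sets M \<and> D \<subseteq> A \<and> measure M D \<le> c) \<and> C \<subseteq> D \<and>
        measure M D - measure M C \<ge> s C / 2"
      if "C \<in> sets M \<and> C \<subseteq> A \<and> measure M C \<le> c" for C and n :: nat
      using step[of C] that by auto
  qed
  then obtain C where
      C': "\<forall>n. (C n \<in> sets M \<and> C n \<subseteq> A \<and> measure M (C n) \<le> c) \<and>
        (C n \<subseteq> C (Suc n) \<and> measure M (C (Suc n)) - measure M (C n) \<ge> s (C n) / 2)" ..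
  have C: "\<And>n. C n \<in> sets M" "\<And>n. C n \<subseteq> A" "\<And>n. measure M (C n) \<le> c"
      "\<And>n. C n \<subseteq> C (Suc n)" "\<And>n. measure M (C (Suc n)) - measure M (C n) \<ge> s (C n) / 2"
    using C' by simp_all
  define B where "B = (\<Union>n. C n)"
  have Bm: "B \<in> sets M" and BA: "B \<subseteq> A" using C by (auto simp: B_def)
  have lim: "(\<lambda>n. measure M (C n)) \<longlonglongrightarrow> measure M B"
    unfolding B_def by (rule finite_Lim_measure_incseq) (use C(1) incseq_SucI[of C, OF C(4)] in auto)
  have Bc: "measure M B \<le> c" by (rule LIMSEQ_le_const2[OF lim]) (use C in auto)
  have "measure M B = c"
  proof (rule ccontr)
    assume "measure M B \<noteq> c"
    then have lt: "measure M B < c" using Bc by auto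
    have "measure M (A - B) = measure M A - measure M B" by (rule finite_measure_Diff[OF A Bm BA])
    then have "0 < measure M (A - B)" using lt measure_nonneg[of M B] unfolding c_def by linarith
    then obtain E where E: "E \<in> sets M" "E \<subseteq> A - B" "0 < measure M E" "measure M E \<le> c - measure M B"
      using nonatomic_small_subset[OF na, of "A - B" "c - measure M B"] A Bm lt by auto
    have "measure M E \<le> 2 * (measure M (C (Suc n)) - measure M (C n))" for n
    proof -
      have "measure M (C n) \<le> measure M B" by (rule finite_measure_mono) (use Bm in \<open>auto simp: B_def\<close>)
      then have "E \<in> adm (C n)" using E by (auto simp: adm_def B_def)
      then have "measure M E \<le> s (C n)" unfolding s_def by (intro cSup_upper bdd) auto
      then show ?thesis using C(5)[of n] by auto
    qed
    moreover have "(\<lambda>n. 2 * (measure M (C (Suc n)) - measure M (C n))) \<longlonglongrightarrow> 2 * (measure M B - measure M B)"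
      by (intro tendsto_intros lim LIMSEQ_Suc)
    ultimately have "measure M E \<le> 2 * (measure M B - measure M B)"
      by (intro LIMSEQ_le_const) auto
    then show False using E by auto
  qed
  then show ?thesis using Bm BA by (auto simp: c_def)
qed

text \<open>\<open>A\<close> stays arbitrary in the induction because a splitting of one set
  requires halving all of its cells. The constant 1 is carried along because both conversions
  control measures through it.\<close>

lemma nonatomic_simultaneous_halving:
  assumes na: "nonatomic M" and "finite F" "F \<subseteq> ess_bounded M" and "A \<in> sets M"
  shows "\<exists>B\<in>sets M. B \<subseteq> A \<and> (\<forall>f\<in>insert (\<lambda>_. 1) F. (LINT x:B|M. f x) = (LINT x:A|M. f x) / 2)"
  using assms(2-4)
proof (induction F arbitrary: A rule: finite_induct)
  case empty
  obtain B where "B \<in> sets M" "B \<subseteq> A" "measure M B = measure M A / 2"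
    using nonatomic_halving[OF na empty(2)] by auto
  then show ?case using empty by (auto intro!: bexI[of _ B] simp: set_integral_one)
next
  case (insert g F)
  let ?F = "insert (\<lambda>_. 1) F"
  have F: "?F \<subseteq> ess_bounded M" using insert by (auto intro: ess_boundedI[where C=1])
  obtain V where V: "V \<in> borel_measurable M" "\<And>x. V x \<in> {0..1}"
    "\<And>f t. f \<in> ?F \<Longrightarrow> t \<in> {0..1} \<Longrightarrow> (LINT x:{x\<in>A. V x \<le> t}|M. f x) = t * (LINT x:A|M. f x)"
    using halving_imp_uniform_splitting[OF F insertI1 insert.IH insert.prems(2)] insert.prems(1)
    by blast
  obtain B where "B \<in> sets M" "B \<subseteq> A"
      "\<forall>f\<in>insert g ?F. (LINT x:B|M. f x) = (LINT x:A|M. f x) / 2"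
    using uniform_splitting_imp_halving[OF F insertI1 _ insert.prems(2) V, of g] insert.prems by auto
  then show ?case by auto
qed

lemma nonatomic_uniform_splitting:
  assumes na: "nonatomic M" and F: "finite F" "F \<subseteq> ess_bounded M"
  obtains V where "V \<in> borel_measurable M" "\<And>x. V x \<in> {0..1}"
    "\<And>f t. f \<in> F \<Longrightarrow> t \<in> {0..1} \<Longrightarrow> (LINT x:{x\<in>space M. V x \<le> t}|M. f x) = t * (LINT x|M. f x)"
proof -
  let ?F = "insert (\<lambda>_. 1) F"
  have F': "?F \<subseteq> ess_bounded M" using F by (auto intro: ess_boundedI[where C=1])
  obtain V where V: "V \<in> borel_measurable M" "\<And>x. V x \<in> {0..1}"
    "\<And>f t. f \<in> ?F \<Longrightarrow> t \<in> {0..1} \<Longrightarrow>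
      (LINT x:{x\<in>space M. V x \<le> t}|M. f x) = t * (LINT x:space M|M. f x)"
    using halving_imp_uniform_splitting[OF F' insertI1 nonatomic_simultaneous_halving[OF na F] sets.top]
    by blast
  show thesis
    by (rule that[OF V(1,2)]) (use V(3) F' ess_bounded_integrable in \<open>auto simp: set_integral_space\<close>)
qed

subsection \<open>Purification\<close>

text \<open>Each step moves \<open>p\<close> by \<open>\<plusminus> min p (1 - p)\<close>, the sign being chosen by a set that halves
  all moments; wherever \<open>p\<close> is not yet in \<open>{0, 1}\<close>, one of the two signs settles it.\<close>

lemma purification_step:
  assumes na: "nonatomic M" and F: "finite F" "F \<subseteq> ess_bounded M"
    and p: "p \<in> borel_measurable M" "\<And>x. p x \<in> {0..1::real}"
  shows "\<exists>q. q \<in> borel_measurable M \<and> (\<forall>x. q x \<in> {0..1}) \<and>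
    (\<forall>f\<in>F. (LINT x|M. q x * f x) = (LINT x|M. p x * f x)) \<and>
    (\<forall>x. p x \<in> {0, 1} \<longrightarrow> q x = p x) \<and>
    measure M {x\<in>space M. q x \<notin> {0, 1}} \<le> measure M {x\<in>space M. p x \<notin> {0, 1}} / 2"
proof -
  note [measurable] = p(1)
  define \<phi> where "\<phi> x = min (p x) (1 - p x)" for x
  have \<phi>m [measurable]: "\<phi> \<in> borel_measurable M" unfolding \<phi>_def[abs_def] by measurable
  have \<phi>b: "\<phi> \<in> ess_bounded M"
    by (rule ess_boundedI[where C=1]) (use p(2) \<phi>m in \<open>auto simp: \<phi>_def\<close>)
  \<comment> \<open>The new \<open>q\<close> vanishes on \<open>L\<close> outside \<open>S\<close>
    and equals 1 on \<open>R\<close> inside \<open>S\<close>, so only \<open>L \<inter> S\<close>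
    and \<open>R - S\<close> can remain fractional. The indicators of \<open>L\<close> and
    \<open>R\<close> join the moments so that \<open>S\<close> cuts each of these sets in
    half.\<close>
  define L where "L = {x\<in>space M. 0 < p x \<and> p x < 1/2}"
  define R where "R = {x\<in>space M. 1/2 \<le> p x \<and> p x < 1}"
  have LR [measurable]: "L \<in> sets M" "R \<in> sets M" unfolding L_def R_def by measurable
  let ?G = "{indicator L, indicator R} \<union> (\<lambda>f x. \<phi> x * f x) ` F"
  have "finite ?G" "?G \<subseteq> ess_bounded M"
    using F \<phi>b LR by (auto intro!: ess_bounded_mult ess_bounded_indicator)
  from nonatomic_simultaneous_halving[OF na this sets.top]
  obtain S where S [measurable]: "S \<in> sets M"
    and half: "\<And>f. f \<in> ?G \<Longrightarrow> (LINT x:S|M. f x) = (LINT x:space M|M. f x) / 2"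
    by blast
  define q where "q x = p x + \<phi> x * (2 * indicator S x - 1)" for x
  have qm [measurable]: "q \<in> borel_measurable M" unfolding q_def[abs_def] by measurable
  have q01: "q x \<in> {0..1}" for x
    using p(2)[of x] by (auto simp: q_def \<phi>_def indicator_def)
  have "(LINT x|M. q x * f x) = (LINT x|M. p x * f x)" if f: "f \<in> F" for f
  proof -
    have fb: "f \<in> ess_bounded M" using f F by auto
    have pb: "p \<in> ess_bounded M" by (rule ess_boundedI[where C=1]) (use p in auto)
    have i1: "integrable M (\<lambda>x. p x * f x)" "integrable M (\<lambda>x. \<phi> x * f x)"
      using fb pb \<phi>b by (auto intro!: ess_bounded_integrable ess_bounded_mult)
    have i2: "integrable M (\<lambda>x. indicator S x * (\<phi> x * f x))"
      using ess_bounded_set_integrable[OF ess_bounded_mult[OF \<phi>b fb] S] by (simp add: set_integrable_def)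
    have h: "(LINT x|M. indicator S x * (\<phi> x * f x)) = (LINT x|M. \<phi> x * f x) / 2"
      using half[of "\<lambda>x. \<phi> x * f x"] f set_integral_space[OF i1(2)]
      by (auto simp: set_lebesgue_integral_def)
    have "(LINT x|M. q x * f x) = (LINT x|M. p x * f x + 2 * (indicator S x * (\<phi> x * f x)) - \<phi> x * f x)"
      by (intro Bochner_Integration.integral_cong) (auto simp: q_def algebra_simps)
    also have "\<dots> = (LINT x|M. p x * f x)" using i1 i2 h by simp
    finally show ?thesis .
  qed
  moreover have "q x = p x" if "p x \<in> {0, 1}" for x using that by (auto simp: q_def \<phi>_def)
  moreover have "measure M {x\<in>space M. q x \<notin> {0, 1}} \<le> measure M {x\<in>space M. p x \<notin> {0, 1}} / 2"
  proof -
    have cut: "measure M (T \<inter> S) = measure M T / 2" if "indicator T \<in> ?G" "T \<in> sets M" for T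
    proof -
      have "(LINT x:S|M. indicator T x) = (LINT x|M. indicator (T \<inter> S) x :: real)"
        unfolding set_lebesgue_integral_def
        by (intro Bochner_Integration.integral_cong) (auto simp: indicator_def)
      moreover have "(LINT x:space M|M. indicator T x :: real) = measure M T"
        using that set_integral_space[of M "indicator T :: _ \<Rightarrow> real"] ess_bounded_integrable[OF ess_bounded_indicator] by auto
      ultimately show ?thesis using half[OF that(1)] that(2) S by simp
    qed
    have N: "{x\<in>space M. p x \<notin> {0, 1}} = L \<union> R"
      using p(2) by (auto simp: L_def R_def less_le)
    have "measure M {x\<in>space M. q x \<notin> {0, 1}} \<le> measure M ((L \<inter> S) \<union> (R - R \<inter> S))"
    proof (rule finite_measure_mono)
      show "{x\<in>space M. q x \<notin> {0, 1}} \<subseteq> (L \<inter> S) \<union> (R - R \<inter> S)"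
      proof
        fix x assume x: "x \<in> {x\<in>space M. q x \<notin> {0, 1}}"
        have "p x \<noteq> 0" "p x \<noteq> 1" using x by (auto simp: q_def \<phi>_def)
        then have "0 < p x" "p x < 1" using p(2)[of x] by auto
        then show "x \<in> (L \<inter> S) \<union> (R - R \<inter> S)"
          using x by (cases "p x < 1/2"; cases "x \<in> S") (auto simp: L_def R_def q_def \<phi>_def)
      qed
    qed auto
    also have "\<dots> \<le> measure M (L \<inter> S) + measure M (R - R \<inter> S)" by (rule measure_subadditive) (auto simp: emeasure_eq_measure)
    also have "\<dots> = measure M L / 2 + measure M R / 2"
      using cut[of L] cut[of R] finite_measure_Diff[of R "R \<inter> S"] by auto
    also have "\<dots> = measure M (L \<union> R) / 2"
    proof -
      have "L \<inter> R = {}" by (auto simp: L_def R_def)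
      then show ?thesis using finite_measure_Union[of L R] LR by simp
    qed
    finally show ?thesis unfolding N .
  qed
  ultimately show ?thesis using qm q01 by blast
qed

text \<open>Values in \<open>{0, 1}\<close> are never changed again and the fractional set shrinks
  geometrically, so almost every point is eventually frozen. The indicator of the limit set
  \<open>B\<close> differs from \<open>q n\<close> only on \<open>N (q n)\<close>, and an
  essentially bounded moment cannot see that set in the limit.\<close>

lemma lyapunov_purification:
  assumes na: "nonatomic M" and F: "finite F" "F \<subseteq> ess_bounded M"
    and p: "p \<in> borel_measurable M" "\<And>x. p x \<in> {0..1::real}"
  shows "\<exists>B\<in>sets M. \<forall>f\<in>F. (LINT x:B|M. f x) = (LINT x|M. p x * f x)"
proof -
  define N where "N p = {x\<in>space M. p x \<notin> {0, 1::real}}" for p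
  define P where "P n q \<longleftrightarrow> q \<in> borel_measurable M \<and> (\<forall>x. q x \<in> {0..1}) \<and>
    (\<forall>f\<in>F. (LINT x|M. q x * f x) = (LINT x|M. p x * f x)) \<and>
    measure M (N q) \<le> measure M (space M) / 2 ^ n" for n :: nat and q
  have "\<exists>q. \<forall>n. P n (q n) \<and> (\<forall>x. q n x \<in> {0, 1} \<longrightarrow> q (Suc n) x = q n x)"
  proof (rule dependent_nat_choice)
    show "\<exists>q. P 0 q" using p by (intro exI[of _ p]) (auto simp: P_def bounded_measure)
  next
    fix q n assume q: "P n q"
    then obtain r where "r \<in> borel_measurable M" "\<forall>x. r x \<in> {0..1}"
      "\<forall>f\<in>F. (LINT x|M. r x * f x) = (LINT x|M. q x * f x)"
      "\<forall>x. q x \<in> {0, 1} \<longrightarrow> r x = q x" "measure M (N r) \<le> measure M (N q) / 2"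
      using purification_step[OF na F, of q] unfolding P_def N_def by blast
    then show "\<exists>r. P (Suc n) r \<and> (\<forall>x. q x \<in> {0, 1} \<longrightarrow> r x = q x)"
      using q by (intro exI[of _ r]) (auto simp: P_def)
  qed
  then obtain q where q: "\<And>n. P n (q n)" "\<And>n x. q n x \<in> {0, 1} \<Longrightarrow> q (Suc n) x = q n x"
    by blast
  have [measurable]: "q n \<in> borel_measurable M" for n using q(1)[of n] by (auto simp: P_def)
  have stable: "q n x = q m x" if "m \<le> n" "q m x \<in> {0, 1}" for m n x
    using that by (induction rule: dec_induct) (use q(2) in metis)+
  define B where "B = {x\<in>space M. \<exists>n. q n x = 1}"
  have [measurable]: "B \<in> sets M" unfolding B_def by measurable
  have Nm [measurable]: "N (q n) \<in> sets M" for n unfolding N_def by measurable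
  have agree: "indicator B x = q n x" if "x \<in> space M" "x \<notin> N (q n)" for x n
  proof -
    have "q n x \<in> {0, 1}" using that by (auto simp: N_def)
    moreover have "x \<notin> B" if "q n x = 0"
    proof
      assume "x \<in> B"
      then obtain m where "q m x = 1" by (auto simp: B_def)
      then show False using stable[of m n x] stable[of n m x] that by (cases "m \<le> n") auto
    qed
    ultimately show ?thesis using that(1) by (auto simp: B_def indicator_def)
  qed
  have "(LINT x:B|M. f x) = (LINT x|M. p x * f x)" if f: "f \<in> F" for f
  proof -
    have fb: "f \<in> ess_bounded M" using f F by auto
    then obtain C where C: "f \<in> borel_measurable M" "AE x in M. \<bar>f x\<bar> \<le> C"
      unfolding ess_bounded_def by auto
    have "\<bar>(LINT x:B|M. f x) - (LINT x|M. p x * f x)\<bar> \<le> \<bar>C\<bar> * measure M (space M) / 2 ^ n" for n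
    proof -
      have q01: "q n x \<in> {0..1}" for x using q(1)[of n] by (auto simp: P_def)
      have qb: "q n \<in> ess_bounded M" by (rule ess_boundedI[where C=1]) (use q01 in auto)
      have i: "integrable M (\<lambda>x. indicator B x * f x)" "integrable M (\<lambda>x. q n x * f x)"
        using fb qb by (auto intro!: ess_bounded_integrable ess_bounded_mult ess_bounded_indicator)
      define g where "g x = (indicator B x - q n x) * f x" for x
      have gm: "g \<in> borel_measurable M" unfolding g_def[abs_def] using C(1) by measurable
      have gC: "AE x in M. \<bar>g x\<bar> \<le> C"
        using C(2)
      proof eventually_elim
        case (elim x)
        have "\<bar>indicator B x - q n x\<bar> * \<bar>f x\<bar> \<le> 1 * \<bar>f x\<bar>"
          using q01[of x] by (intro mult_right_mono) (auto simp: indicator_def)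
        then show ?case using elim by (simp add: g_def abs_mult)
      qed
      have "(LINT x:B|M. f x) - (LINT x|M. p x * f x) = (LINT x:B|M. f x) - (LINT x|M. q n x * f x)"
        using q(1)[of n] f by (auto simp: P_def)
      also have "\<dots> = (LINT x|M. g x)"
        using i by (simp add: set_lebesgue_integral_def g_def left_diff_distrib)
      also have "\<dots> = (LINT x:N (q n)|M. g x)"
        unfolding set_lebesgue_integral_def
      proof (intro Bochner_Integration.integral_cong refl)
        fix x assume "x \<in> space M"
        then show "g x = indicator (N (q n)) x *\<^sub>R g x"
          by (cases "x \<in> N (q n)") (simp_all add: g_def agree)
      qed
      also have "\<bar>\<dots>\<bar> \<le> C * measure M (N (q n))" by (rule set_integral_bound[OF gm gC]) auto
      also have "\<dots> \<le> \<bar>C\<bar> * (measure M (space M) / 2 ^ n)"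
        using q(1)[of n] by (intro mult_mono) (auto simp: P_def)
      finally show ?thesis by simp
    qed
    moreover have "(\<lambda>n. \<bar>C\<bar> * measure M (space M) / 2 ^ n) \<longlonglongrightarrow> 0"
      by (rule LIMSEQ_divide_realpow_zero) simp
    ultimately have "\<bar>(LINT x:B|M. f x) - (LINT x|M. p x * f x)\<bar> \<le> 0"
      by (intro LIMSEQ_le_const) auto
    then show ?thesis by simp
  qed
  then show ?thesis by (intro bexI[of _ B]) auto
qed

text \<open>Purify \<open>q 0\<close> together with the ratios \<open>q k / q 0\<close>, which form a decreasing chain again, and
  recurse on the ratios inside the set obtained. Where \<open>q 0\<close> vanishes so does every \<open>q k\<close>, so the
  value \<open>0 / 0 = 0\<close> is the right one.\<close>

lemma lyapunov_chain:
  assumes na: "nonatomic M" and F: "finite F" "F \<subseteq> ess_bounded M" and A: "A \<in> sets M"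
    and q: "\<And>k. q k \<in> borel_measurable M" "\<And>k x. q k x \<in> {0..1::real}" "\<And>k x. q (Suc k) x \<le> q k x"
  shows "\<exists>B. (\<forall>k<n. B k \<in> sets M \<and> B k \<subseteq> A \<and> (\<forall>f\<in>F. (LINT x:B k|M. f x) = (LINT x:A|M. q k x * f x))) \<and>
    (\<forall>k. Suc k < n \<longrightarrow> B (Suc k) \<subseteq> B k)"
  using A q
proof (induction n arbitrary: A q)
  case 0 then show ?case by auto
next
  case (Suc n)
  note [measurable] = Suc.prems(1,2)
  define r where "r k x = q (Suc k) x / q 0 x" for k x
  have anti: "q k x \<le> q 0 x" for k x
    by (induction k) (use Suc.prems(4) order_trans in blast)+
  have rm [measurable]: "r k \<in> borel_measurable M" for k unfolding r_def[abs_def] by measurable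
  have r01: "r k x \<in> {0..1}" for k x
    using anti[of "Suc k" x] Suc.prems(3)[of "Suc k" x] Suc.prems(3)[of 0 x]
    by (auto simp: r_def divide_le_eq)
  have ranti: "r (Suc k) x \<le> r k x" for k x
    using Suc.prems(3)[of 0 x] Suc.prems(4)[of "Suc k" x] by (auto simp: r_def intro!: divide_right_mono)
  have r_mult: "q 0 x * r k x = q (Suc k) x" for k x
    using anti[of "Suc k" x] Suc.prems(3)[of "Suc k" x] by (auto simp: r_def)
  have rb: "r k \<in> ess_bounded M" for k by (rule ess_boundedI[where C=1]) (use r01 in auto)
  \<comment> \<open>The recursion delivers integrals of \<open>r k * f\<close> over
    \<open>B1\<close>. Purifying these products together with \<open>f\<close> turns them into
    integrals of \<open>q 0 * r k * f\<close>, that is of \<open>q (Suc k) * f\<close>, over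
    \<open>A\<close>.\<close>
  let ?G = "(\<lambda>f x. indicator A x * f x) ` F \<union> (\<Union>k<n. (\<lambda>f x. indicator A x * (r k x * f x)) ` F)"
  have G: "finite ?G" "?G \<subseteq> ess_bounded M"
    using F rb Suc.prems(1) by (auto intro!: ess_bounded_mult ess_bounded_indicator)
  from lyapunov_purification[OF na G Suc.prems(2)[of 0] Suc.prems(3)[of 0]]
  obtain B0 where B0: "B0 \<in> sets M"
      "\<And>f. f \<in> ?G \<Longrightarrow> (LINT x:B0|M. f x) = (LINT x|M. q 0 x * f x)"
    by (elim bexE) simp
  define B1 where "B1 = A \<inter> B0"
  have B1: "B1 \<in> sets M" "B1 \<subseteq> A" using B0 Suc.prems by (auto simp: B1_def)
  have transfer: "(LINT x:B1|M. g x) = (LINT x:A|M. q 0 x * g x)" if "(\<lambda>x. indicator A x * g x) \<in> ?G" for g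
  proof -
    have "(LINT x:B1|M. g x) = (LINT x:B0|M. indicator A x * g x)"
      unfolding set_lebesgue_integral_def B1_def
      by (intro Bochner_Integration.integral_cong) (auto simp: indicator_def)
    also have "\<dots> = (LINT x|M. q 0 x * (indicator A x * g x))" by (rule B0(2)[OF that])
    also have "\<dots> = (LINT x:A|M. q 0 x * g x)"
      unfolding set_lebesgue_integral_def
      by (intro Bochner_Integration.integral_cong) (auto simp: indicator_def)
    finally show ?thesis .
  qed
  from Suc.IH[of B1 r, OF B1(1) rm r01 ranti]
  obtain B where
    "(\<forall>k<n. B k \<in> sets M \<and> B k \<subseteq> B1 \<and>
      (\<forall>f\<in>F. (LINT x:B k|M. f x) = (LINT x:B1|M. r k x * f x))) \<and>
      (\<forall>k. Suc k < n \<longrightarrow> B (Suc k) \<subseteq> B k)" ..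
  then have B: "\<And>k. k < n \<Longrightarrow> B k \<in> sets M \<and> B k \<subseteq> B1 \<and>
      (\<forall>f\<in>F. (LINT x:B k|M. f x) = (LINT x:B1|M. r k x * f x))"
    "\<And>k. Suc k < n \<Longrightarrow> B (Suc k) \<subseteq> B k"
    by simp_all
  define B' where "B' = case_nat B1 B"
  have ints: "(LINT x:B' k|M. f x) = (LINT x:A|M. q k x * f x)" if "k < Suc n" "f \<in> F" for k f
  proof (cases k)
    case 0
    then show ?thesis using transfer[of f] that by (auto simp: B'_def)
  next
    case (Suc j)
    then have "j < n" using that by auto
    then have "(LINT x:B1|M. r j x * f x) = (LINT x:A|M. q 0 x * (r j x * f x))"
      using that by (intro transfer) auto
    then show ?thesis using Suc B(1)[OF \<open>j < n\<close>] that r_mult by (simp add: B'_def mult.assoc[symmetric])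
  qed
  show ?case
  proof (intro exI[of _ B'] conjI allI impI ballI)
    fix k assume k: "k < Suc n"
    show "B' k \<in> sets M" "B' k \<subseteq> A"
      using k B(1) B1 by (auto simp: B'_def split: nat.splits)
    show "(LINT x:B' k|M. f x) = (LINT x:A|M. q k x * f x)" if "f \<in> F" for f
      by (rule ints[OF k that])
  next
    fix k assume "Suc k < Suc n"
    then show "B' (Suc k) \<subseteq> B' k" using B by (auto simp: B'_def split: nat.splits)
  qed
qed

end

subsection \<open>From decreasing families to uniform variables and back\<close>

abbreviation clip :: "real \<Rightarrow> real" where
  "clip x \<equiv> max 0 (min 1 x)"

text \<open>Unit ramps placed end to end form one ramp of length \<open>n\<close>. Each summand will
  be the share of one layer of \<open>V\<close> below a given level.\<close>

lemma sum_clip: "(\<Sum>k<n. clip (x - real k)) = max 0 (min (real n) x)"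
proof (induction n)
  case (Suc n)
  have "max 0 (min (real n) x) + clip (x - real n) = max 0 (min (real (Suc n)) x)"
    by (simp add: max_def min_def)
  then show ?case using Suc by simp
qed simp

text \<open>The points of the unit interval below \<open>v\<close> have total length
  \<open>clip v\<close>. The clipping is kept because a uniform law places \<open>V\<close> in the
  unit interval only almost surely.\<close>

lemma set_integral_layer_cake:
  fixes v y :: real
  shows "(LINT t:{0..1}|lborel. indicator {t<..} v * y) = clip v * y"
proof -
  have "(LINT t:{0..1}|lborel. indicator {t<..} v * y)
      = (LINT t|lborel. indicator ({0..1} \<inter> {..<v}) t * y)"
    unfolding set_lebesgue_integral_def
    by (intro Bochner_Integration.integral_cong) (auto simp: indicator_def)
  also have "\<dots> = measure lborel ({0..1} \<inter> {..<v}) * y" by simp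
  also have "measure lborel ({0..1} \<inter> {..<v}) = clip v"
  proof (cases "v \<le> 1")
    case True
    then have "{0..1} \<inter> {..<v} = {0..<v}" by auto
    then have "measure lborel ({0..1} \<inter> {..<v}) = measure lborel {0..<v}" by (rule arg_cong)
    then show ?thesis using True by (cases "0 \<le> v") simp_all
  next
    case False
    then have "{0..1::real} \<inter> {..<v} = {0..1}" by auto
    then have "measure lborel ({0..1::real} \<inter> {..<v}) = measure lborel {0..1::real}" by (rule arg_cong)
    then show ?thesis using False by simp
  qed
  finally show ?thesis .
qed

text \<open>The left and right Riemann sums enclose the integral. Both contain the terms
  \<open>1..<n\<close>, and the end terms \<open>u 0\<close> and \<open>u 1\<close> lie in the unit
  interval, so dropping them costs at most \<open>1 / n\<close>.\<close>

lemma antimono_Riemann_sum_bound: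
  fixes u :: "real \<Rightarrow> real"
  assumes u: "set_borel_measurable lborel {0..1} u" "\<And>t. t \<in> {0..1} \<Longrightarrow> u t \<in> {0..1}"
    and anti: "\<And>s t. s \<in> {0..1} \<Longrightarrow> t \<in> {0..1} \<Longrightarrow> s \<le> t \<Longrightarrow> u t \<le> u s"
    and n: "0 < n"
  shows "\<bar>(\<Sum>k=1..<n. u (real k / real n)) / real n - (LINT t:{0..1}|lborel. u t)\<bar> \<le> 1 / real n"
proof -
  define J where "J k = {real k / real n..<real (Suc k) / real n}" for k
  define step where "step c t = (\<Sum>k<n. c k * indicator (J k) t)" for c :: "nat \<Rightarrow> real" and t
  have mJ: "measure lborel (J k) = 1 / real n" for k
    using n by (simp add: J_def divide_right_mono add_divide_distrib)
  have fJ: "emeasure lborel (J k) < \<infinity>" for k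
    using n by (simp add: J_def divide_right_mono)
  have iJ: "integrable lborel (\<lambda>t. c * indicator (J k) t :: real)" for c k
    using fJ[of k] by (intro integrable_mult_right integrable_real_indicator) (auto simp: J_def)
  have i_step: "integrable lborel (step c)" for c
    unfolding step_def[abs_def] by (intro Bochner_Integration.integrable_sum iJ)
  have int_step: "(LINT t|lborel. step c t) = (\<Sum>k<n. c k) / n" for c
  proof -
    have "(LINT t|lborel. step c t) = (\<Sum>k<n. LINT t|lborel. c k * indicator (J k) t)"
      unfolding step_def by (intro Bochner_Integration.integral_sum iJ)
    also have "\<dots> = (\<Sum>k<n. c k * (1 / real n))"
      by (intro sum.cong refl) (simp add: mJ)
    finally show ?thesis by (simp add: sum_divide_distrib)
  qed
  have iu: "integrable lborel (\<lambda>t. indicator {0..1} t *\<^sub>R u t)"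
  proof (rule Bochner_Integration.integrable_bound[where f="indicator {0..1} :: real \<Rightarrow> real"])
    show "AE t in lborel. norm (indicator {0..1} t *\<^sub>R u t) \<le> norm (indicator {0..1} t :: real)"
      using u(2) by (auto simp: indicator_def)
  qed (use u(1) in \<open>auto simp: set_borel_measurable_def intro!: integrable_real_indicator\<close>)
  have step_eq: "\<exists>m<n. step c t = c m \<and> real m / n \<le> t \<and> t < real (Suc m) / n"
    if "0 \<le> t" "t < 1" for c t
  proof -
    define m where "m = nat \<lfloor>real n * t\<rfloor>"
    have m: "real m \<le> real n * t" "real n * t < real m + 1" using that by (auto simp: m_def)
    have "real n * t < real n" using that n by auto
    then have mn: "m < n" using m(1) by linarith
    have J: "t \<in> J k \<longleftrightarrow> k = m" for k
    proof -
      have "t \<in> J k \<longleftrightarrow> real k \<le> real n * t \<and> real n * t < real k + 1"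
        using n by (auto simp: J_def field_simps)
      also have "\<dots> \<longleftrightarrow> k = m" using m by auto
      finally show ?thesis .
    qed
    have "step c t = (\<Sum>k<n. if k = m then c k else 0)"
      unfolding step_def by (intro sum.cong refl) (auto simp: indicator_def J)
    then have "step c t = c m" using mn by simp
    moreover have "t \<in> J m" by (simp add: J)
    ultimately show ?thesis using mn by (auto simp: J_def)
  qed
  have step0: "step c t = 0" if "\<not> (0 \<le> t \<and> t < 1)" for c t
  proof -
    have "t \<notin> J k" if "k < n" for k
    proof
      assume t: "t \<in> J k"
      have "0 \<le> real k / n" by simp
      moreover have "real (Suc k) / n \<le> 1" using that n by simp
      moreover have "real k / n \<le> t" "t < real (Suc k) / n" using t by (auto simp: J_def)
      ultimately show False using \<open>\<not> (0 \<le> t \<and> t < 1)\<close> by linarith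
    qed
    then show ?thesis by (auto simp: step_def)
  qed
  have in01: "real k / n \<in> {0..1}" if "k \<le> n" for k using that n by auto
  have "(LINT t|lborel. step (\<lambda>k. u (real (Suc k) / n)) t) \<le> (LINT t:{0..1}|lborel. u t)"
    unfolding set_lebesgue_integral_def
  proof (rule integral_mono[OF i_step iu])
    fix t :: real
    show "step (\<lambda>k. u (real (Suc k) / n)) t \<le> indicator {0..1} t *\<^sub>R u t"
    proof (cases "0 \<le> t \<and> t < 1")
      case True
      then obtain m where "m < n" "step (\<lambda>k. u (real (Suc k) / n)) t = u (real (Suc m) / n)"
          "t < real (Suc m) / n"
        using step_eq by blast
      then show ?thesis using anti[of t "real (Suc m) / n"] in01[of "Suc m"] True by auto
    next
      case False
      then show ?thesis using step0[OF False] u(2)[of t] by (auto simp: indicator_def)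
    qed
  qed
  then have lower: "(\<Sum>k<n. u (real (Suc k) / n)) / n \<le> (LINT t:{0..1}|lborel. u t)"
    by (simp only: int_step)
  have "(LINT t:{0..1}|lborel. u t) \<le> (LINT t|lborel. step (\<lambda>k. u (real k / n)) t)"
    unfolding set_lebesgue_integral_def
  proof (rule integral_mono_AE[OF iu i_step])
    \<comment> \<open>The half-open intervals miss \<open>t = 1\<close>, where the step function is
      0 but \<open>u 1\<close> may be positive.\<close>
    show "AE t in lborel. indicator {0..1} t *\<^sub>R u t \<le> step (\<lambda>k. u (real k / n)) t"
      using AE_lborel_singleton[of 1]
    proof eventually_elim
      case (elim t)
      show ?case
      proof (cases "0 \<le> t \<and> t < 1")
        case True
        then obtain m where "m < n" "step (\<lambda>k. u (real k / n)) t = u (real m / n)"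
            "real m / n \<le> t"
          using step_eq by blast
        then show ?thesis using anti[of "real m / n" t] in01[of m] True by auto
      next
        case False
        then show ?thesis using step0[OF False] elim by (auto simp: indicator_def)
      qed
    qed
  qed
  then have upper: "(LINT t:{0..1}|lborel. u t) \<le> (\<Sum>k<n. u (real k / n)) / n"
    by (simp only: int_step)
  let ?S = "\<Sum>k=1..<n. u (real k / n)"
  have "(\<Sum>k<n. u (real (Suc k) / n)) = (\<Sum>k=1..<Suc n. u (real k / n))"
    using sum.shift_bounds_Suc_ivl[of "\<lambda>k. u (real k / n)" 0 n] by (simp add: lessThan_atLeast0)
  also have "\<dots> = ?S + u 1" using n by simp
  finally have l: "?S \<le> (\<Sum>k<n. u (real (Suc k) / n))" using u(2)[of 1] by simp
  have "(\<Sum>k<n. u (real k / n)) = u 0 + ?S"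
    using n by (simp add: lessThan_atLeast0 sum.atLeast_Suc_lessThan)
  then have r: "(\<Sum>k<n. u (real k / n)) \<le> 1 + ?S" using u(2)[of 0] by simp
  have "?S / n \<le> (LINT t:{0..1}|lborel. u t)"
    using lower divide_right_mono[OF l, of "real n"] by auto
  moreover have "(LINT t:{0..1}|lborel. u t) \<le> 1 / n + ?S / n"
    using upper divide_right_mono[OF r, of "real n"] by (auto simp: add_divide_distrib)
  ultimately show ?thesis by (auto simp: abs_le_iff)
qed

context prob_space
begin

section \<open>Testing the law and the conditional expectation on sublevel sets\<close>

lemma finite_measure_subalgebra_vimage_algebra:
  assumes "V \<in> borel_measurable M"
  shows "finite_measure_subalgebra M (vimage_algebra (space M) V borel)"
proof (intro finite_measure_subalgebra.intro finite_measure_subalgebra_axioms.intro)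
  show "subalgebra M (vimage_algebra (space M) V borel)"
    using assms by (auto simp: subalgebra_def sets_vimage_algebra2 measurable_sets)
qed unfold_locales

text \<open>A Dynkin argument: half-lines are stable under intersection and generate the Borel sets.
  The vanishing passes to complements because \<open>g\<close> has mean 0, and to disjoint unions by
  countable additivity.\<close>

lemma set_integral_vimage_eq_zero:
  fixes V g :: "'a \<Rightarrow> real"
  assumes V: "V \<in> borel_measurable M" and g: "g \<in> ess_bounded M" and g0: "(LINT x|M. g x) = 0"
    and cdf: "\<And>s. (LINT x:{x\<in>space M. V x \<le> s}|M. g x) = 0" and S: "S \<in> sets borel"
  shows "(LINT x:V -` S \<inter> space M|M. g x) = 0"
proof -
  have S': "S \<in> sigma_sets UNIV (range atMost)"
    using S unfolding borel_eq_atMost by simp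
  have sb: "T \<in> sets borel" if "T \<in> sigma_sets UNIV (range atMost)" for T :: "real set"
    using that unfolding borel_eq_atMost by simp
  have Vm: "V -` T \<inter> space M \<in> sets M" if "T \<in> sigma_sets UNIV (range atMost)" for T
    using measurable_sets[OF V sb[OF that]] .
  have "Int_stable (range (atMost :: real \<Rightarrow> _))"
    by (auto simp: Int_stable_def)
  moreover have "range (atMost :: real \<Rightarrow> _) \<subseteq> Pow UNIV" by simp
  ultimately show ?thesis using S'
  proof (induction S rule: sigma_sets_induct_disjoint)
    case (basic T)
    then obtain s where "T = {..s}" by auto
    moreover have "V -` {..s} \<inter> space M = {x\<in>space M. V x \<le> s}" by auto
    ultimately show ?case using cdf by simp
  next
    case empty
    show ?case by (simp add: set_lebesgue_integral_def)
  next
    case (compl T)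
    have "V -` (UNIV - T) \<inter> space M = space M - (V -` T \<inter> space M)" by auto
    then show ?case
      using set_integral_Diff_subset[OF g sets.top Vm[OF compl(1)]] compl(2) g0
        set_integral_space[OF ess_bounded_integrable[OF g]] by auto
  next
    case (union T)
    have "V -` (\<Union>i. T i) \<inter> space M = (\<Union>i. V -` T i \<inter> space M)" by auto
    moreover have "(LINT x:(\<Union>i. V -` T i \<inter> space M)|M. g x) = (\<Sum>i. LINT x:V -` T i \<inter> space M|M. g x)"
    proof (rule lebesgue_integral_countable_add)
      show m: "V -` T i \<inter> space M \<in> sets M" for i using union(2) by (intro Vm) auto
      show "i \<noteq> j \<Longrightarrow> (V -` T i \<inter> space M) \<inter> (V -` T j \<inter> space M) = {}" for i j
        using union(1) by (auto simp: disjoint_family_on_def)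
      show "set_integrable M (\<Union>i. V -` T i \<inter> space M) g"
        using m by (intro ess_bounded_set_integrable g sets.countable_UN) auto
    qed
    ultimately show ?case using union(3) by simp
  qed
qed

lemma distr_eq_uniformI:
  fixes V :: "'a \<Rightarrow> real"
  assumes V: "V \<in> borel_measurable M"
    and cdf: "\<And>s. measure M {x\<in>space M. V x \<le> s} = clip s"
  shows "distr M lborel V = uniform_measure lborel {0..1}"
proof (rule cdf_unique)
  have Vl: "V \<in> measurable M lborel" using V by simp
  show "real_distribution (distr M lborel V)"
    using prob_space_distr[OF Vl] by (simp add: real_distribution_def real_distribution_axioms_def)
  have "prob_space (uniform_measure lborel {0..1::real})"
    by (rule prob_space_uniform_measure) auto
  then show "real_distribution (uniform_measure lborel {0..1::real})"
    by (simp add: real_distribution_def real_distribution_axioms_def)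
  show "cdf (distr M lborel V) = cdf (uniform_measure lborel {0..1})"
  proof
    fix s
    have "V -` {..s} \<inter> space M = {x\<in>space M. V x \<le> s}" by auto
    then have "cdf (distr M lborel V) s = clip s"
      using measure_distr[OF Vl, of "{..s}"] cdf by (simp add: cdf_def)
    moreover have "{0..1} \<inter> {..s} = {0..min 1 s}" by auto
    then have "cdf (uniform_measure lborel {0..1}) s = clip s"
      by (simp add: cdf_def measure_uniform_measure)
    ultimately show "cdf (distr M lborel V) s = cdf (uniform_measure lborel {0..1}) s" by simp
  qed
qed

text \<open>Sublevel sets are what a splitting controls, and they determine both the law of
  \<open>V\<close> and whether \<open>X\<close> is conditionally centred.\<close>

lemma adm_VI:
  fixes X :: "'a \<Rightarrow> real^'n"
  assumes V: "V \<in> borel_measurable M" and X: "\<And>i. (\<lambda>x. X x $ i) \<in> ess_bounded M"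
    and mean: "\<And>i. (LINT x|M. X x $ i) = 0"
    and cdf: "\<And>s. measure M {x\<in>space M. V x \<le> s} = clip s"
    and ortho: "\<And>i s. (LINT x:{x\<in>space M. V x \<le> s}|M. X x $ i) = 0"
  shows "adm_V M X V"
proof -
  interpret finite_measure_subalgebra M "vimage_algebra (space M) V borel"
    by (rule finite_measure_subalgebra_vimage_algebra[OF V])
  have "AE x in M. real_cond_exp M (vimage_algebra (space M) V borel) (\<lambda>x. X x $ i) x = 0" for i
  proof (rule real_cond_exp_charact)
    fix A assume "A \<in> sets (vimage_algebra (space M) V borel)"
    then obtain S where "S \<in> sets borel" "A = V -` S \<inter> space M"
      by (auto simp: sets_vimage_algebra2)
    then have "(LINT x:A|M. X x $ i) = 0"
      using set_integral_vimage_eq_zero[OF V X mean ortho] by simp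
    then show "(LINT x:A|M. X x $ i) = (LINT x:A|M. 0)" by simp
  qed (auto intro: ess_bounded_integrable X)
  then show ?thesis using V distr_eq_uniformI[OF V cdf] by (simp add: adm_V_def)
qed

section \<open>From a uniform variable to a decreasing family\<close>

lemma integrable_weighted_component:
  fixes X :: "'a \<Rightarrow> real^'n"
  assumes X: "integrable M X" and u: "u \<in> borel_measurable M" "\<And>x. x \<in> space M \<Longrightarrow> u x \<in> {0..1::real}"
  shows "(LINT x|M. u x *\<^sub>R X x) $ i = (LINT x|M. u x * X x $ i)"
proof -
  have "integrable M (\<lambda>x. u x *\<^sub>R X x)"
  proof (rule Bochner_Integration.integrable_bound[OF X])
    show "AE x in M. norm (u x *\<^sub>R X x) \<le> norm (X x)"
      using u(2) by (auto intro!: AE_I2 mult_left_le_one_le)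
  qed (use X u(1) in measurable)
  then show ?thesis
    using integral_bounded_linear[OF bounded_linear_vec_nth, of M "\<lambda>x. u x *\<^sub>R X x" i] by simp
qed

lemma adm_V_AE_unit_interval:
  assumes "adm_V M X V"
  shows "AE x in M. V x \<in> {0..1}"
proof -
  have V: "V \<in> measurable M lborel" "distr M lborel V = uniform_measure lborel {0..1}"
    using assms by (auto simp: adm_V_def)
  have "AE v in distr M lborel V. v \<in> {0..1}"
    unfolding V(2) by (rule AE_uniform_measureI) auto
  then show ?thesis by (rule AE_distrD[OF V(1)])
qed

text \<open>The event \<open>{V > t}\<close> lies in the sigma-algebra of \<open>V\<close>, so
  \<open>X\<close> may be replaced there by its conditional expectation, which is 0.\<close>

lemma adm_V_imp_adm_U:
  fixes X :: "'a \<Rightarrow> real^'n"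
  assumes V: "adm_V M X V" and X: "integrable M X" and mean: "(LINT x|M. X x) = 0"
  shows "adm_U M X (\<lambda>t x. indicator {t<..} (V x))"
proof -
  have Vm [measurable]: "V \<in> borel_measurable M"
    and Vd: "distr M lborel V = uniform_measure lborel {0..1}"
    and Vc: "\<And>i. AE x in M. real_cond_exp M (vimage_algebra (space M) V borel) (\<lambda>x. X x $ i) x = 0"
    using V by (auto simp: adm_V_def)
  interpret sub: finite_measure_subalgebra M "vimage_algebra (space M) V borel"
    by (rule finite_measure_subalgebra_vimage_algebra[OF Vm])
  have [measurable]: "(\<lambda>t. t) \<in> borel_measurable (restrict_space lborel {0..1::real})"
    by (rule measurable_restrict_space1) simp
  have joint: "(\<lambda>(t, x). indicator {t<..} (V x) :: real) \<in> borel_measurable (restrict_space lborel {0..1} \<Otimes>\<^sub>M M)"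
  proof -
    have "(\<lambda>p. if fst p < V (snd p) then 1 else 0 :: real) \<in> borel_measurable (restrict_space lborel {0..1} \<Otimes>\<^sub>M M)"
      by measurable
    moreover have "(\<lambda>(t, x). indicator {t<..} (V x) :: real) = (\<lambda>p. if fst p < V (snd p) then 1 else 0)"
      by (auto simp: fun_eq_iff indicator_def)
    ultimately show ?thesis by simp
  qed
  have ind: "indicator {t<..} (V x) = (indicator (V -` {t<..} \<inter> space M) x :: real)" if "x \<in> space M" for t x
    using that by (auto simp: indicator_def)
  have prob: "(LINT x|M. indicator {t<..} (V x)) = 1 - t" if "t \<in> {0..1}" for t
  proof -
    have "(LINT x|M. indicator {t<..} (V x)) = (LINT x|M. indicator (V -` {t<..} \<inter> space M) x :: real)"
      by (intro Bochner_Integration.integral_cong refl ind)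
    also have "\<dots> = measure M (V -` {t<..} \<inter> space M)" by simp
    also have "\<dots> = measure (distr M lborel V) {t<..}"
      by (rule measure_distr[symmetric]) auto
    also have "\<dots> = measure lborel ({0..1} \<inter> {t<..})"
      unfolding Vd by (subst measure_uniform_measure) auto
    also have "{0..1} \<inter> {t<..} = {t<..1}" using that by auto
    finally show ?thesis using that by simp
  qed
  have ortho: "(LINT x|M. indicator {t<..} (V x) *\<^sub>R X x) = 0" for t
  proof (subst vec_eq_iff, intro allI)
    fix i
    let ?A = "V -` {t<..} \<inter> space M"
    have Xi: "integrable M (\<lambda>x. X x $ i)"
      using integrable_bounded_linear[OF bounded_linear_vec_nth X] .
    have "(LINT x|M. indicator {t<..} (V x) *\<^sub>R X x) $ i = (LINT x|M. indicator {t<..} (V x) * X x $ i)"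
      by (rule integrable_weighted_component[OF X]) (auto simp: indicator_def)
    also have "\<dots> = (LINT x:?A|M. X x $ i)"
      unfolding set_lebesgue_integral_def
      by (intro Bochner_Integration.integral_cong) (auto simp: ind)
    also have "\<dots> = (LINT x:?A|M. real_cond_exp M (vimage_algebra (space M) V borel) (\<lambda>x. X x $ i) x)"
      by (rule sub.real_cond_exp_intA[OF Xi]) (auto intro: in_vimage_algebra)
    also have "\<dots> = (LINT x|M. 0)"
      unfolding set_lebesgue_integral_def
    proof (rule integral_cong_AE)
      show "AE x in M. indicator ?A x *\<^sub>R real_cond_exp M (vimage_algebra (space M) V borel) (\<lambda>x. X x $ i) x = 0"
        using Vc[of i] by eventually_elim simp
    qed auto
    finally show "(LINT x|M. indicator {t<..} (V x) *\<^sub>R X x) $ i = 0 $ i" by simp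
  qed
  show ?thesis
    unfolding adm_U_def using joint prob ortho by (auto simp: indicator_def)
qed

lemma adm_V_value:
  assumes V: "adm_V M X V" and Y: "Y \<in> borel_measurable M"
  shows "(LINT x|M. V x * Y x) = (LINT x|M. (LINT t:{0..1}|lborel. indicator {t<..} (V x) * Y x))"
proof -
  have [measurable]: "V \<in> borel_measurable M" "Y \<in> borel_measurable M" using V Y by (auto simp: adm_V_def)
  have "(LINT x|M. V x * Y x) = (LINT x|M. clip (V x) * Y x)"
  proof (rule integral_cong_AE)
    show "AE x in M. V x * Y x = clip (V x) * Y x"
      using adm_V_AE_unit_interval[OF V] by eventually_elim auto
  qed measurable
  then show ?thesis by (simp only: set_integral_layer_cake)
qed

section \<open>From a decreasing family to a uniform variable\<close>

text \<open>Each layer \<open>B j - B (Suc j)\<close> has probability \<open>1 / n\<close> and is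
  orthogonal to \<open>X\<close>. On it the sum of indicators equals \<open>j\<close>, the term for
  \<open>B 0\<close> being left out, so \<open>V\<close> spreads the layer over the interval from
  \<open>j / n\<close> to \<open>(j + 1) / n\<close> by means of \<open>W\<close>.\<close>

lemma adm_V_exists_of_chain:
  fixes X :: "'a \<Rightarrow> real^'n"
  assumes na: "nonatomic M" and X: "\<And>i. (\<lambda>x. X x $ i) \<in> ess_bounded M"
    and mean: "\<And>i. (LINT x|M. X x $ i) = 0" and n: "0 < n"
    and B: "\<And>k. B k \<in> sets M" "\<And>k. B (Suc k) \<subseteq> B k" "B 0 = space M" "B n = {}"
    and prob: "\<And>k. k \<le> n \<Longrightarrow> measure M (B k) = 1 - real k / real n"
    and ortho: "\<And>k i. k \<le> n \<Longrightarrow> (LINT x:B k|M. X x $ i) = 0"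
  shows "\<exists>W\<in>borel_measurable M. (\<forall>x. W x \<in> {0..1}) \<and>
    adm_V M X (\<lambda>x. ((\<Sum>k=1..<n. indicator (B k) x) + W x) / real n)"
proof -
  define A where "A j = B j - B (Suc j)" for j
  have Am: "A j \<in> sets M" for j using B by (auto simp: A_def)
  have B_anti: "i \<le> j \<Longrightarrow> B j \<subseteq> B i" for i j
    using lift_Suc_antimono_le[of B, OF B(2)] by blast
  have A_mem: "x \<in> B k \<longleftrightarrow> k \<le> j" if "x \<in> A j" for x j k
    using that B_anti[of k j] B_anti[of "Suc j" k] by (auto simp: A_def not_less_eq_eq[symmetric])
  have A_cover: "\<exists>j<n. x \<in> A j" if "x \<in> space M" for x
    using ex_least_nat_less[of "\<lambda>k. x \<notin> B k" n] B(3,4) that by (auto simp: A_def)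
  have A_disj: "i = j" if "x \<in> A i" "x \<in> A j" for x i j
    using A_mem[OF that(1), of i] A_mem[OF that(1), of j] A_mem[OF that(2), of i] A_mem[OF that(2), of j]
    by auto
  define c :: "('a \<Rightarrow> real) \<Rightarrow> real" where "c g = (if g = (\<lambda>_. 1) then 1 / real n else 0)" for g
  define G where "G = insert (\<lambda>_. 1) (range (\<lambda>i x. X x $ i))"
  have Gb: "G \<subseteq> ess_bounded M" using X by (auto simp: G_def intro: ess_boundedI[where C=1])
  \<comment> \<open>Localising the moments by the indicators of the layers lets one splitting of the
    whole space serve all layers at once.\<close>
  define H where "H = (\<Union>j<n. (\<lambda>g x. indicator (A j) x * g x) ` G)"
  have "finite H" "H \<subseteq> ess_bounded M"
    using Gb Am by (auto simp: H_def G_def intro!: ess_bounded_mult ess_bounded_indicator X)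
  from nonatomic_uniform_splitting[OF na this] obtain W where
    W [measurable]: "W \<in> borel_measurable M" and W01: "\<And>x. W x \<in> {0..1}" and
    split: "\<And>f t. f \<in> H \<Longrightarrow> t \<in> {0..1} \<Longrightarrow>
      (LINT x:{x\<in>space M. W x \<le> t}|M. f x) = t * (LINT x|M. f x)"
    by blast
  define V where "V x = ((\<Sum>k=1..<n. indicator (B k) x) + W x) / real n" for x
  note [measurable] = Am B(1)
  have Vm [measurable]: "V \<in> borel_measurable M" unfolding V_def[abs_def] by measurable
  have V_on: "V x = (real j + W x) / n" if "x \<in> A j" "j < n" for x j
  proof -
    have "(\<Sum>k=1..<n. indicator (B k) x :: real) = (\<Sum>k=1..<n. if k \<in> {1..j} then 1 else 0)"
      using A_mem[OF that(1)] by (intro sum.cong) (auto simp: indicator_def)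
    also have "\<dots> = (\<Sum>k\<in>{1..<n} \<inter> {1..j}. 1)" by (rule sum.inter_restrict[symmetric]) simp
    also have "{1..<n} \<inter> {1..j} = {1..j}" using that by auto
    finally show ?thesis by (simp add: V_def)
  qed
  have cell: "(LINT x:{x\<in>space M. V x \<le> s}|M. indicator (A j) x * g x) = clip (real n * s - real j) * (LINT x:A j|M. g x)"
    if j: "j < n" and g: "g \<in> G" for j g s
  proof -
    define \<tau> where "\<tau> = real n * s - real j"
    have V_iff: "V x \<le> s \<longleftrightarrow> W x \<le> \<tau>" if "x \<in> A j" for x
      using n unfolding V_on[OF that j] \<tau>_def by (auto simp: field_simps)
    have eq: "(LINT x:{x\<in>space M. V x \<le> s}|M. indicator (A j) x * g x) = (LINT x:{x\<in>space M. W x \<le> \<tau>}|M. indicator (A j) x * g x)"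
      unfolding set_lebesgue_integral_def
      by (intro Bochner_Integration.integral_cong) (auto simp: indicator_def V_iff)
    have Aj: "(LINT x|M. indicator (A j) x * g x) = (LINT x:A j|M. g x)"
      by (simp add: set_lebesgue_integral_def)
    \<comment> \<open>\<open>W\<close> stays in the unit interval, so a threshold outside it selects
      nothing or the whole layer; \<open>clip\<close> records both cases.\<close>
    consider "\<tau> < 0" | "\<tau> \<in> {0..1}" | "1 < \<tau>" by fastforce
    then have "(LINT x:{x\<in>space M. W x \<le> \<tau>}|M. indicator (A j) x * g x) = clip \<tau> * (LINT x:A j|M. g x)"
    proof cases
      case 1
      then have "\<not> W x \<le> \<tau>" for x using W01[of x] by auto
      then show ?thesis using 1 by (simp add: set_lebesgue_integral_def)
    next
      case 2
      have "(\<lambda>x. indicator (A j) x * g x) \<in> H" using j g by (auto simp: H_def)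
      then show ?thesis using split[OF _ 2] 2 Aj by auto
    next
      case 3
      then have "W x \<le> \<tau>" for x using W01[of x] by auto
      then have "{x\<in>space M. W x \<le> \<tau>} = space M" by auto
      then have "(LINT x:{x\<in>space M. W x \<le> \<tau>}|M. indicator (A j) x * g x) = (LINT x|M. indicator (A j) x * g x)"
        unfolding set_lebesgue_integral_def by (intro Bochner_Integration.integral_cong) auto
      then show ?thesis using 3 Aj by auto
    qed
    then show ?thesis unfolding eq \<tau>_def .
  qed
  \<comment> \<open>Since every layer has the same integral \<open>c\<close>, the layer shares add
    up by \<open>sum_clip\<close>. The choice \<open>c = 1 / n\<close> yields the distribution
    function, and \<open>c = 0\<close> the orthogonality to \<open>X\<close>.\<close>
  have total: "(LINT x:{x\<in>space M. V x \<le> s}|M. g x) = real n * clip s * c"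
    if g: "g \<in> G" and c: "\<And>j. j < n \<Longrightarrow> (LINT x:A j|M. g x) = c" for g s c
  proof -
    have [measurable]: "{x\<in>space M. V x \<le> s} \<in> sets M" by measurable
    have ind: "(\<Sum>j<n. indicator (A j) x :: real) = 1" if x: "x \<in> space M" for x
    proof -
      obtain j where j: "j < n" "x \<in> A j" using A_cover[OF x] by auto
      have "(\<Sum>j<n. indicator (A j) x :: real) = (\<Sum>i<n. if i = j then 1 else 0)"
      proof (rule sum.cong)
        fix i
        have "x \<in> A i \<longleftrightarrow> i = j" using A_disj j(2) by blast
        then show "(indicator (A i) x :: real) = (if i = j then 1 else 0)" by (simp add: indicator_def)
      qed simp
      then show ?thesis using j by simp
    qed
    have "(LINT x:{x\<in>space M. V x \<le> s}|M. g x)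
        = (LINT x|M. (\<Sum>j<n. indicator {x\<in>space M. V x \<le> s} x *\<^sub>R (indicator (A j) x * g x)))"
      unfolding set_lebesgue_integral_def
    proof (intro Bochner_Integration.integral_cong refl)
      fix x assume x: "x \<in> space M"
      have "(\<Sum>j<n. indicator {x\<in>space M. V x \<le> s} x *\<^sub>R (indicator (A j) x * g x))
          = indicator {x\<in>space M. V x \<le> s} x * ((\<Sum>j<n. indicator (A j) x) * g x)"
        by (simp only: sum_distrib_left sum_distrib_right real_scaleR_def)
      then show "indicator {x\<in>space M. V x \<le> s} x *\<^sub>R g x
          = (\<Sum>j<n. indicator {x\<in>space M. V x \<le> s} x *\<^sub>R (indicator (A j) x * g x))"
        by (simp only: ind[OF x] real_scaleR_def mult_1)
    qed
    also have "\<dots> = (\<Sum>j<n. LINT x:{x\<in>space M. V x \<le> s}|M. indicator (A j) x * g x)"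
      unfolding set_lebesgue_integral_def
    proof (rule Bochner_Integration.integral_sum)
      fix j
      have "(\<lambda>x. indicator (A j) x * g x) \<in> ess_bounded M"
        using g Gb Am by (auto intro!: ess_bounded_mult ess_bounded_indicator)
      then show "integrable M (\<lambda>x. indicator {x\<in>space M. V x \<le> s} x *\<^sub>R (indicator (A j) x * g x))"
        using ess_bounded_set_integrable[of _ "{x\<in>space M. V x \<le> s}"] by (simp add: set_integrable_def)
    qed
    also have "\<dots> = (\<Sum>j<n. clip (real n * s - real j)) * c"
      using cell g c by (simp add: sum_distrib_right)
    also have "(\<Sum>j<n. clip (real n * s - real j)) = real n * clip s"
      unfolding sum_clip using n by (auto simp: max_def min_def mult_le_0_iff zero_le_mult_iff)
    finally show ?thesis .
  qed
  have "adm_V M X V"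
  proof (rule adm_VI[OF Vm X mean])
    fix s
    have "(LINT x:A j|M. 1) = 1 / real n" if "j < n" for j
    proof -
      have "measure M (A j) = measure M (B j) - measure M (B (Suc j))"
        unfolding A_def by (rule finite_measure_Diff) (use B in auto)
      also have "\<dots> = 1 / real n"
        using prob[of j] prob[of "Suc j"] that by (simp add: add_divide_distrib)
      finally show ?thesis using Am by (simp add: set_integral_one)
    qed
    then have "(LINT x:{x\<in>space M. V x \<le> s}|M. 1) = real n * clip s * (1 / real n)"
      by (intro total) (auto simp: G_def)
    then show "measure M {x\<in>space M. V x \<le> s} = clip s"
      using n by (simp add: set_integral_one)
  next
    fix i s
    have "(LINT x:A j|M. X x $ i) = 0" if "j < n" for j
      unfolding A_def using that ortho[of j] ortho[of "Suc j"]
      by (subst set_integral_Diff_subset) (use B X in auto)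
    then have "(LINT x:{x\<in>space M. V x \<le> s}|M. X x $ i) = real n * clip s * 0"
      by (intro total) (auto simp: G_def)
    then show "(LINT x:{x\<in>space M. V x \<le> s}|M. X x $ i) = 0" by simp
  qed
  then show ?thesis using W W01 unfolding V_def[abs_def] by blast
qed

text \<open>Only finitely many levels \<open>U (k / n)\<close> are purified. Inside each resulting layer \<open>V\<close> is filled in by
  a uniform splitting that is orthogonal to \<open>X\<close>, which costs at most \<open>1 / n\<close> in \<open>V\<close>.\<close>

lemma adm_V_approximates_adm_U:
  fixes X :: "'a \<Rightarrow> real^'n"
  assumes na: "nonatomic M" and XI: "integrable M X" and X: "\<And>i. (\<lambda>x. X x $ i) \<in> ess_bounded M"
    and mean: "\<And>i. (LINT x|M. X x $ i) = 0"
    and Y: "Y \<in> borel_measurable M" "AE x in M. \<bar>Y x\<bar> \<le> C"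
    and U: "adm_U M X U" and n: "0 < n"
  shows "\<exists>V. adm_V M X V \<and>
    \<bar>(LINT x|M. V x * Y x) - (LINT x|M. (LINT t:{0..1}|lborel. U t x * Y x))\<bar> \<le> 2 * C / real n"
proof -
  define N where "N = restrict_space lborel {0..1::real}"
  have joint: "(\<lambda>(t, x). U t x) \<in> borel_measurable (N \<Otimes>\<^sub>M M)"
    and anti: "\<And>x s t. x \<in> space M \<Longrightarrow> s \<in> {0..1} \<Longrightarrow> t \<in> {0..1} \<Longrightarrow> s \<le> t \<Longrightarrow> U t x \<le> U s x"
    and U01: "\<And>x t. x \<in> space M \<Longrightarrow> t \<in> {0..1} \<Longrightarrow> U t x \<in> {0..1}"
    and U1: "\<And>t. t \<in> {0..1} \<Longrightarrow> (LINT x|M. U t x) = 1 - t"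
    and UX: "\<And>t. t \<in> {0..1} \<Longrightarrow> (LINT x|M. U t x *\<^sub>R X x) = 0"
    using U by (auto simp: adm_U_def N_def)
  have Yb: "Y \<in> ess_bounded M" using Y by (auto simp: ess_bounded_def)
  have spN: "space N = {0..1}" by (simp add: N_def space_restrict_space)
  have Um: "U t \<in> borel_measurable M" if "t \<in> {0..1}" for t
    using measurable_Pair2[OF joint, of t] that by (simp add: spN)
  \<comment> \<open>The chain lemma asks for a sequence over all naturals with bounds at every
    point. Hence the levels are capped at 1 and the values outside the space are set to 0.\<close>
  define q where "q k x = (if x \<in> space M then U (min 1 (real k / real n)) x else 0)" for k :: nat and x
  have in01: "min 1 (real k / real n) \<in> {0..1}" for k by auto
  have q: "\<And>k. q k \<in> borel_measurable M" "\<And>k x. q k x \<in> {0..1}" "\<And>k x. q (Suc k) x \<le> q k x"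
  proof -
    show "q k \<in> borel_measurable M" for k
      using Um[OF in01[of k]] by (subst measurable_cong[where g="U (min 1 (real k / real n))"]) (auto simp: q_def)
    show "q k x \<in> {0..1}" for k x using U01[OF _ in01[of k], of x] by (auto simp: q_def)
    have "min 1 (real k / real n) \<le> min 1 (real (Suc k) / real n)" for k
      by (intro min.mono divide_right_mono) auto
    then show "q (Suc k) x \<le> q k x" for k x
      using anti[OF _ in01 in01, of x k "Suc k"] by (auto simp: q_def)
  qed
  let ?F = "insert Y (insert (\<lambda>_. 1) (range (\<lambda>i x. X x $ i)))"
  have F: "finite ?F" "?F \<subseteq> ess_bounded M" using X Yb by (auto intro: ess_boundedI[where C=1])
  from lyapunov_chain[OF na F sets.top, of q n, OF q]
  obtain B where B': "(\<forall>k<n. B k \<in> sets M \<and> B k \<subseteq> space M \<and>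
      (\<forall>f\<in>?F. (LINT x:B k|M. f x) = (LINT x:space M|M. q k x * f x))) \<and>
      (\<forall>k. Suc k < n \<longrightarrow> B (Suc k) \<subseteq> B k)" ..
  have B: "\<And>k. k < n \<Longrightarrow> B k \<in> sets M" "\<And>k. Suc k < n \<Longrightarrow> B (Suc k) \<subseteq> B k"
    using B' by auto
  have B_int: "(LINT x:B k|M. f x) = (LINT x|M. U (real k / real n) x * f x)" if "k < n" "f \<in> ?F" for k f
  proof -
    have "(LINT x:B k|M. f x) = (LINT x:space M|M. q k x * f x)" using B' that by auto
    also have "\<dots> = (LINT x|M. U (real k / real n) x * f x)"
      unfolding set_lebesgue_integral_def
      by (intro Bochner_Integration.integral_cong) (use that in \<open>auto simp: q_def min_def\<close>)
    finally show ?thesis .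
  qed
  \<comment> \<open>The layers must exhaust the space exactly, but the moments only make
    \<open>B 0\<close> a set of full measure. Both ends of the chain are therefore put in by
    hand.\<close>
  define D where "D k = (if k = 0 then space M else if n \<le> k then {} else B k)" for k
  have D: "D k \<in> sets M" "D (Suc k) \<subseteq> D k" "D 0 = space M" "D n = {}" for k
    using B sets.sets_into_space[OF B(1)] n by (auto simp: D_def dest: less_imp_le)
  have frac: "real k / real n \<in> {0..1}" if "k \<le> n" for k using that n by auto
  have prob: "measure M (D k) = 1 - real k / real n" if "k \<le> n" for k
  proof (cases "0 < k \<and> k < n")
    case True
    then have "measure M (D k) = (LINT x|M. U (real k / real n) x * 1)"
      using B_int[of k "\<lambda>_. 1"] B(1)[of k] by (simp add: D_def set_integral_one)
    then show ?thesis using U1[OF frac[OF that]] by simp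
  next
    case False
    then have "k = 0 \<or> k = n" using that by auto
    then show ?thesis using n by (auto simp: D_def prob_space)
  qed
  have ortho: "(LINT x:D k|M. X x $ i) = 0" if "k \<le> n" for k i
  proof (cases "0 < k \<and> k < n")
    case True
    then have "(LINT x:D k|M. X x $ i) = (LINT x|M. U (real k / real n) x * X x $ i)"
      using B_int[of k "\<lambda>x. X x $ i"] by (simp add: D_def)
    also have "\<dots> = (LINT x|M. U (real k / real n) x *\<^sub>R X x) $ i"
      by (rule integrable_weighted_component[OF XI Um U01, symmetric]) (use frac[OF that] in auto)
    finally show ?thesis using UX[OF frac[OF that]] by simp
  next
    case False
    then have "k = 0 \<or> k = n" using that by auto
    then show ?thesis using n mean[of i] set_integral_space[OF ess_bounded_integrable[OF X[of i]]]
      by (auto simp: D_def set_lebesgue_integral_def)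
  qed
  obtain W where W: "W \<in> borel_measurable M" "\<And>x. W x \<in> {0..1}"
    and V: "adm_V M X (\<lambda>x. ((\<Sum>k=1..<n. indicator (D k) x) + W x) / real n)"
    using adm_V_exists_of_chain[OF na X mean n D prob ortho] by blast
  define V where "V x = ((\<Sum>k=1..<n. indicator (D k) x) + W x) / real n" for x
  define I where "I x = (LINT t:{0..1}|lborel. U t x)" for x
  define R where "R x = (\<Sum>k=1..<n. U (real k / real n) x) / real n" for x
  have RI: "\<bar>R x - I x\<bar> \<le> 1 / real n" if x: "x \<in> space M" for x
    unfolding R_def I_def
  proof (rule antimono_Riemann_sum_bound[OF _ _ _ n])
    have "(\<lambda>t. U t x) \<in> borel_measurable N" using measurable_Pair1[OF joint x] by simp
    then show "set_borel_measurable lborel {0..1} (\<lambda>t. U t x)"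
      unfolding N_def set_borel_measurable_def by (subst (asm) borel_measurable_restrict_space_iff) (auto simp: mult.commute)
  qed (use U01 anti x in auto)
  have Im: "I \<in> borel_measurable M"
  proof -
    have "finite_measure N"
      by (rule finite_measureI) (simp add: N_def space_restrict_space emeasure_restrict_space)
    then interpret N: finite_measure N .
    have "(\<lambda>x. LINT t|N. U t x) \<in> borel_measurable M"
      using measurable_pair_swap[OF joint] by (intro N.borel_measurable_lebesgue_integral) (simp add: case_prod_unfold)
    moreover have "(LINT t|N. U t x) = I x" for x
      unfolding I_def N_def set_lebesgue_integral_def by (rule integral_restrict_space) simp
    ultimately show ?thesis by simp
  qed
  have Rm: "R \<in> borel_measurable M"
    unfolding R_def[abs_def] by (intro borel_measurable_divide borel_measurable_sum Um frac) auto
  \<comment> \<open>Crude bounds from \<open>R\<close> lying in the unit interval and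
    \<open>RI\<close>; their purpose is the boundedness of \<open>I\<close>.\<close>
  have I01: "I x \<in> {- 1 / n..2}" if "x \<in> space M" for x
  proof -
    have "0 \<le> R x" unfolding R_def
      by (intro divide_nonneg_nonneg sum_nonneg) (use U01[OF that frac] in auto)
    moreover have "(\<Sum>k=1..<n. U (real k / real n) x) \<le> (\<Sum>k=1..<n. 1)"
      by (intro sum_mono) (use U01[OF that frac] in auto)
    then have "R x \<le> 1" using n by (auto simp: R_def)
    moreover have "1 / real n \<le> 1" using n by simp
    ultimately show ?thesis using RI[OF that] by (auto simp: abs_le_iff)
  qed
  \<comment> \<open>At the interior levels \<open>D k\<close> and \<open>U (k / n)\<close> have the
    same integral against \<open>Y\<close>. What remains is the Riemann error and the filling
    \<open>W / n\<close>, each at most \<open>1 / n\<close> in size, whence the constant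
    \<open>2 * C / n\<close>.\<close>
  define Z where "Z x = (R x - I x) * Y x + W x / n * Y x" for x
  have RIb: "(\<lambda>x. R x - I x) \<in> ess_bounded M"
    using Rm Im by (intro ess_boundedI[where C="1 / n"] RI) auto
  have Wb: "W \<in> ess_bounded M" by (rule ess_boundedI[where C=1]) (use W in auto)
  have Ib: "I \<in> ess_bounded M"
  proof (rule ess_boundedI[OF Im])
    show "\<bar>I x\<bar> \<le> 2" if "x \<in> space M" for x
    proof -
      have "1 / real n \<le> 1" using n by simp
      then show ?thesis using I01[OF that] by (auto simp: abs_le_iff)
    qed
  qed
  have UYi: "integrable M (\<lambda>x. U (real k / real n) x * Y x)" if "k \<le> n" for k
    using Um[OF frac[OF that]] U01[OF _ frac[OF that]] Yb
    by (intro ess_bounded_integrable ess_bounded_mult) (auto intro!: ess_boundedI[where C=1])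
  have DYi: "integrable M (\<lambda>x. indicator (D k) x * Y x)" for k
    using Yb D(1) by (intro ess_bounded_integrable ess_bounded_mult ess_bounded_indicator)
  have WYi: "integrable M (\<lambda>x. W x * Y x)" "integrable M (\<lambda>x. I x * Y x)" "integrable M (\<lambda>x. (R x - I x) * Y x)"
    using RIb Wb Ib Yb by (auto intro!: ess_bounded_integrable ess_bounded_mult)
  have EV: "(LINT x|M. V x * Y x) = ((\<Sum>k=1..<n. LINT x|M. indicator (D k) x * Y x) + (LINT x|M. W x * Y x)) / n"
  proof -
    define d where "d k x = indicator (D k) x * Y x" for k x
    have "V x * Y x = ((\<Sum>k=1..<n. d k x) + W x * Y x) / n" for x
      unfolding V_def d_def sum_distrib_right[symmetric] by (simp only: times_divide_eq_left distrib_right)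
    then have "(LINT x|M. V x * Y x) = (LINT x|M. ((\<Sum>k=1..<n. d k x) + W x * Y x) / n)"
      by simp
    then show ?thesis unfolding d_def[symmetric] using DYi[folded d_def] WYi by simp
  qed
  have ER: "(LINT x|M. R x * Y x) = (\<Sum>k=1..<n. LINT x|M. U (real k / real n) x * Y x) / n"
  proof -
    have "(LINT x|M. R x * Y x) = (LINT x|M. (\<Sum>k=1..<n. U (real k / real n) x * Y x) / n)"
      by (simp add: R_def sum_distrib_right)
    then show ?thesis using UYi by simp
  qed
  have "(LINT x|M. indicator (D k) x * Y x) = (LINT x|M. U (real k / real n) x * Y x)" if "k \<in> {1..<n}" for k
    using B_int[of k Y] that by (auto simp: D_def set_lebesgue_integral_def)
  then have EV': "(LINT x|M. V x * Y x) = (LINT x|M. R x * Y x) + (LINT x|M. W x * Y x) / n"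
    unfolding EV ER by (simp add: add_divide_distrib)
  have "integrable M (\<lambda>x. (R x - I x) * Y x + I x * Y x)" using WYi by (intro Bochner_Integration.integrable_add)
  then have RYi: "integrable M (\<lambda>x. R x * Y x)" by (simp add: left_diff_distrib)
  have EI: "(LINT x|M. (LINT t:{0..1}|lborel. U t x * Y x)) = (LINT x|M. I x * Y x)"
    by (simp add: I_def)
  have "(LINT x|M. Z x) = (LINT x|M. (R x * Y x - I x * Y x) + W x * Y x / n)"
    by (intro Bochner_Integration.integral_cong) (auto simp: Z_def left_diff_distrib)
  then have Z: "(LINT x|M. V x * Y x) - (LINT x|M. (LINT t:{0..1}|lborel. U t x * Y x)) = (LINT x|M. Z x)"
    unfolding EV' EI using RYi WYi by simp
  have Zb: "AE x in M. \<bar>Z x\<bar> \<le> 2 * C / n"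
    using Y(2) AE_space
  proof eventually_elim
    case (elim x)
    have "\<bar>(R x - I x) * Y x\<bar> \<le> 1 / n * C"
      unfolding abs_mult using RI elim by (intro mult_mono) auto
    moreover have "\<bar>W x / n * Y x\<bar> \<le> 1 / n * C"
      unfolding abs_mult using W(2)[of x] elim n by (intro mult_mono) (auto simp: divide_right_mono)
    ultimately have "\<bar>Z x\<bar> \<le> 1 / n * C + 1 / n * C"
      unfolding Z_def by (rule order_trans[OF abs_triangle_ineq add_mono])
    then show ?case by simp
  qed
  have "Z \<in> borel_measurable M"
    unfolding Z_def[abs_def] using Rm Im W(1) Y(1) by measurable
  then have "\<bar>LINT x:space M|M. Z x\<bar> \<le> 2 * C / n * measure M (space M)"
    using Zb by (intro set_integral_bound) auto
  moreover have "(LINT x:space M|M. Z x) = (LINT x|M. Z x)"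
    unfolding set_lebesgue_integral_def by (intro Bochner_Integration.integral_cong) auto
  ultimately show ?thesis
    using V Z by (intro exI[of _ V]) (simp add: V_def[abs_def] prob_space)
qed

text \<open>A deterministic family, feasible because \<open>X\<close> is centred. It makes the
  second supremum one over a nonempty set.\<close>

lemma adm_U_linear:
  fixes X :: "'a \<Rightarrow> real^'n"
  assumes "(LINT x|M. X x) = 0"
  shows "adm_U M X (\<lambda>t x. 1 - t)"
proof -
  have [measurable]: "(\<lambda>t. t) \<in> borel_measurable (restrict_space lborel {0..1::real})"
    by (rule measurable_restrict_space1) simp
  have "(\<lambda>(t, x). 1 - t) \<in> borel_measurable (restrict_space lborel {0..1::real} \<Otimes>\<^sub>M M)"
    by measurable
  then show ?thesis using assms by (simp add: adm_U_def prob_space)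
qed

end

section \<open>Comparison of the two suprema\<close>

theorem mainTheorem11:
  fixes M :: "'a measure" and X :: "'a \<Rightarrow> real^'n" and Y :: "'a \<Rightarrow> real"
  assumes "prob_space M"
    and "nonatomic M"
    and "X \<in> borel_measurable M"
    and "\<exists>C. AE \<omega> in M. norm (X \<omega>) \<le> C"
    and "(\<integral>\<omega>. X \<omega> \<partial>M) = 0"
    and "Y \<in> borel_measurable M"
    and "\<exists>C. AE \<omega> in M. \<bar>Y \<omega>\<bar> \<le> C"
  shows "Sup {(\<integral>\<omega>. V \<omega> * Y \<omega> \<partial>M) | V. adm_V M X V}
       = Sup {(\<integral>\<omega>. (LINT t:{0..1}|lborel. U t \<omega> * Y \<omega>) \<partial>M) | U. adm_U M X U}"
proof -
  interpret prob_space M by fact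
  obtain CX where CX: "AE \<omega> in M. norm (X \<omega>) \<le> CX" using assms(4) by auto
  obtain C where C: "AE \<omega> in M. \<bar>Y \<omega>\<bar> \<le> C" using assms(7) by auto
  have XI: "integrable M X" by (rule integrable_const_bound[OF CX assms(3)])
  have X: "(\<lambda>\<omega>. X \<omega> $ i) \<in> ess_bounded M" for i
  proof -
    have "AE \<omega> in M. \<bar>X \<omega> $ i\<bar> \<le> CX"
      using CX by eventually_elim (meson component_le_norm_cart order_trans)
    then show ?thesis using borel_measurable_integrable[OF integrable_bounded_linear[OF bounded_linear_vec_nth XI, of i]]
      by (auto simp: ess_bounded_def)
  qed
  have mean: "(\<integral>\<omega>. X \<omega> $ i \<partial>M) = 0" for i
    using integral_bounded_linear[OF bounded_linear_vec_nth XI, of i] assms(5) by simp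
  define SV where "SV = {(\<integral>\<omega>. V \<omega> * Y \<omega> \<partial>M) | V. adm_V M X V}"
  define SU where "SU = {(\<integral>\<omega>. (LINT t:{0..1}|lborel. U t \<omega> * Y \<omega>) \<partial>M) | U. adm_U M X U}"
  have sub: "SV \<subseteq> SU"
    unfolding SV_def SU_def using adm_V_imp_adm_U[OF _ XI assms(5)] adm_V_value[OF _ assms(6)] by fastforce
  have near: "\<exists>v\<in>SV. \<bar>v - u\<bar> \<le> 2 * C / real n" if "u \<in> SU" "0 < n" for u n
    using adm_V_approximates_adm_U[OF assms(2) XI X mean assms(6) C _ that(2)] that(1)
    unfolding SV_def SU_def by blast
  \<comment> \<open>A real \<open>Sup\<close> carries information only for a nonempty set bounded
    above. The approximation with \<open>n = 1\<close> passes nonemptiness on to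
    \<open>SV\<close>.\<close>
  have neU: "SU \<noteq> {}" using adm_U_linear[OF assms(5)] by (auto simp: SU_def)
  then have neV: "SV \<noteq> {}" using near[of _ 1] by fastforce
  have V_le: "v \<le> C" if v: "v \<in> SV" for v
  proof -
    obtain V where V: "adm_V M X V" "v = (\<integral>\<omega>. V \<omega> * Y \<omega> \<partial>M)" using v by (auto simp: SV_def)
    have "AE \<omega> in M. V \<omega> * Y \<omega> \<le> C"
      using adm_V_AE_unit_interval[OF V(1)] C
    proof eventually_elim
      case (elim \<omega>)
      have "\<bar>V \<omega> * Y \<omega>\<bar> \<le> 1 * C" unfolding abs_mult using elim by (intro mult_mono) auto
      then show ?case by simp
    qed
    moreover have "integrable M (\<lambda>\<omega>. V \<omega> * Y \<omega>)"
    proof (rule integrable_const_bound[where B=C])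
      show "AE \<omega> in M. norm (V \<omega> * Y \<omega>) \<le> C"
        using adm_V_AE_unit_interval[OF V(1)] C
      proof eventually_elim
        case (elim \<omega>)
        have "\<bar>V \<omega> * Y \<omega>\<bar> \<le> 1 * C" unfolding abs_mult using elim by (intro mult_mono) auto
        then show ?case by simp
      qed
    qed (use V(1) assms(6) in \<open>auto simp: adm_V_def\<close>)
    ultimately show ?thesis unfolding V(2) by (intro integral_le_const) auto
  qed
  then have bddV: "bdd_above SV" by (intro bdd_aboveI[of _ C])
  \<comment> \<open>Letting \<open>n\<close> grow in \<open>near\<close> bounds all of
    \<open>SU\<close> by \<open>Sup SV\<close>. This gives one of the two inequalities and also the
    boundedness of \<open>SU\<close> that the other one requires.\<close>
  have U_le: "u \<le> Sup SV" if u: "u \<in> SU" for u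
  proof (rule LIMSEQ_le_const)
    have "(\<lambda>n. Sup SV + (2 * C) * inverse (real (Suc n))) \<longlonglongrightarrow> Sup SV + (2 * C) * 0"
      by (intro tendsto_intros LIMSEQ_inverse_real_of_nat)
    then show "(\<lambda>n. Sup SV + 2 * C / real (Suc n)) \<longlonglongrightarrow> Sup SV" by (simp add: divide_inverse)
    have "u \<le> Sup SV + 2 * C / real (Suc n)" for n
    proof -
      obtain v where "v \<in> SV" "\<bar>v - u\<bar> \<le> 2 * C / real (Suc n)" using near[OF u, of "Suc n"] by blast
      then show ?thesis using cSup_upper[OF _ bddV, of v] by (auto simp: abs_le_iff)
    qed
    then show "\<exists>N. \<forall>n\<ge>N. u \<le> Sup SV + 2 * C / real (Suc n)" by blast
  qed
  have "Sup SV = Sup SU"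
  proof (rule antisym)
    show "Sup SV \<le> Sup SU"
      using U_le by (intro cSup_subset_mono neV sub) (intro bdd_aboveI[of _ "Sup SV"])
    show "Sup SU \<le> Sup SV" by (rule cSup_least[OF neU U_le])
  qed
  then show ?thesis by (simp add: SV_def SU_def)
qed

end
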